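(* Let $\boldsymbol{\phi}\in \mathrm{St}(p,V)$ and $\boldsymbol{\eta}\in T_{\boldsymbol{\phi}}\,\mathrm{St}(p,V)$. Let $\mathcal{E}\colon \mathrm{St}(p,V)\to\mathbb{R}$ be a smooth function, and let $\overline{\mathcal{E}}$ be a smooth extension of $\mathcal{E}$ to a neighbourhood of $\boldsymbol{\phi}$ in $V$, with $L^2$-Sobolev gradient $\nabla\overline{\mathcal{E}}$ and $L^2$-Sobolev Hessian $\nabla^2\overline{\mathcal{E}}$. Then the Riemannian Hessian of $\mathcal{E}$ at $\boldsymbol{\phi}$ with respect to the metric $g(\cdot,\cdot)=(\cdot,\cdot)_H$ satisfies $$\mathrm{Hess}\,\mathcal{E}(\boldsymbol{\phi})[\boldsymbol{\eta}] = \mathcal{P}_{\boldsymbol{\phi}}\bigl(\mathrm{D}\,\mathrm{grad}\,\mathcal{E}(\boldsymbol{\phi})[\boldsymbol{\eta}]\bigr) = \mathcal{P}_{\boldsymbol{\phi}}\Bigl(\nabla^2\overline{\mathcal{E}}(\boldsymbol{\phi})[\boldsymbol{\eta}] - \boldsymbol{\eta}\,\mathrm{sym}\,[\![\boldsymbol{\phi},\nabla\overline{\mathcal{E}}(\boldsymbol{\phi})]\!]_H\Bigr).$$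
   Context: Spaces. Let $\Omega\subseteq\mathbb{R}^d$, $d\le 3$, be a spatial domain, $\tilde V\subseteq H^1(\Omega)$ a (real) Hilbert space, $p\ge 1$, $V=\tilde V^p$, $H=[L^2(\Omega)]^p$; $V$ is assumed dense in $H$ and $V\subseteq H\subseteq V^*$ form a Gelfand triple. Elements are row tuples $\mathbf{v}=(v_1,\dots,v_p)$, and for $M\in\mathbb{R}^{p\times p}$ the product $\mathbf{v}M$ is the tuple with $j$th entry $\sum_i v_iM_{ij}$. For $\mathbf v,\mathbf w\in H$ define the matrix $[\![\mathbf v,\mathbf w]\!]_H=\bigl[(v_i,w_j)_{L^2(\Omega)}\bigr]_{i,j=1}^p\in\mathbb{R}^{p\times p}$ and the inner product $(\mathbf v,\mathbf w)_H=\mathrm{tr}\,[\![\mathbf v,\mathbf w]\!]_H=\sum_j (v_j,w_j)_{L^2(\Omega)}$. For $M\in\mathbb{R}^{p\times p}$, $\mathrm{sym}\,M=\frac12(M+M^T)$. Stiefel manifold. $\mathrm{St}(p,V)=\{\boldsymbol\phi\in V: [\![\boldsymbol\phi,\boldsymbol\phi]\!]_H=I_p\}$, an embedded submanifold of $V$ of co-dimension $p(p+1)/2$, with tangent space $T_{\boldsymbol\phi}\,\mathrm{St}(p,V)=\{\boldsymbol\eta\in V: [\![\boldsymbol\eta,\boldsymbol\phi]\!]_H+[\![\boldsymbol\phi,\boldsymbol\eta]\!]_H=0_p\}$. It is equipped with the metric $g(\boldsymbol\eta,\boldsymbol\zeta)=(\boldsymbol\eta,\boldsymbol\zeta)_H$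 on tangent spaces. The $H$-orthogonal projection of $V$ onto $T_{\boldsymbol\phi}\,\mathrm{St}(p,V)$ is $\mathcal P_{\boldsymbol\phi}(\mathbf y)=\mathbf y-\boldsymbol\phi\,\mathrm{sym}\,[\![\boldsymbol\phi,\mathbf y]\!]_H$. Gradients and Hessians. The $L^2$-Sobolev gradient $\nabla\overline{\mathcal E}(\boldsymbol\phi)\in V$ is the element with $(\nabla\overline{\mathcal E}(\boldsymbol\phi),\mathbf w)_H=\mathrm D\overline{\mathcal E}(\boldsymbol\phi)[\mathbf w]$ for all $\mathbf w\in V$, where $\mathrm D\overline{\mathcal E}$ is the Fréchet derivative in $V$. The $L^2$-Sobolev Hessian $\nabla^2\overline{\mathcal E}(\boldsymbol\phi)$ is the linear operator sending $\mathbf v\in V$ to the element of $V$ representing $\mathrm D^2\overline{\mathcal E}(\boldsymbol\phi)[\mathbf v,\cdot\,]$ with respect to $(\cdot,\cdot)_H$. It is assumed that these representatives exist in $V$ near $\boldsymbol\phi$ and that $\nabla\overline{\mathcal E}$ is a smooth $V$-valued map near $\boldsymbol\phi$. The Riemannian gradient $\mathrm{grad}\,\mathcal E(\boldsymbol\phi)$ is the unique element of $T_{\boldsymbol\phi}\,\mathrm{St}(p,V)$ with $g(\mathrm{grad}\,\mathcal E(\boldsymbol\phi),\boldsymbol\eta)=\mathrm D\overline{\mathcal E}(\boldsymbol\phi)[\boldsymbol\eta]$ for all $\boldsymbol\eta\in T_{\boldsymbol\phi}\,\mathrm{St}(p,V)$; $\mathrm D\,\mathrm{grad}\,\mathcal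 E(\boldsymbol\phi)[\boldsymbol\eta]\in V$ denotes the directional derivative along $\boldsymbol\eta$ of $\mathrm{grad}\,\mathcal E$ regarded as a $V$-valued map on $\mathrm{St}(p,V)$. The Riemannian Hessian is the linear map $\mathrm{Hess}\,\mathcal E(\boldsymbol\phi)\colon T_{\boldsymbol\phi}\,\mathrm{St}(p,V)\to T_{\boldsymbol\phi}\,\mathrm{St}(p,V)$, $\mathrm{Hess}\,\mathcal E(\boldsymbol\phi)[\boldsymbol\eta]=\nabla_{\boldsymbol\eta}\,\mathrm{grad}\,\mathcal E$ evaluated at $\boldsymbol\phi$, where $\nabla_{\boldsymbol\eta}$ is the covariant derivative along $\boldsymbol\eta$ with respect to the Riemannian (Levi-Civita) connection of $g$, i.e. the torsion-free connection on $\mathrm{St}(p,V)$ compatible with $g$. *)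

theory Defs
  imports "HOL-Analysis.Analysis"
begin

section \<open>Smooth maps between normed spaces\<close>

definition bounded_multilinear ::
    "nat \<Rightarrow> ('a::real_normed_vector list \<Rightarrow> 'b::real_normed_vector) \<Rightarrow> bool" where
  "bounded_multilinear n T \<longleftrightarrow>
     (\<forall>vs i. length vs = n \<longrightarrow> i < n \<longrightarrow> linear (\<lambda>v. T (vs[i := v]))) \<and>
     (\<exists>C. \<forall>vs. length vs = n \<longrightarrow> norm (T vs) \<le> C * (\<Prod>v\<leftarrow>vs. norm v))"

text \<open>
  \<open>C\<^sup>\<infinity>\<close> in the sense of Frechet on an open set. The witness \<open>D\<close> collects all derivatives:
  \<open>D x [v\<^sub>1, \<dots>, v\<^sub>n]\<close> is the value of the \<open>n\<close>-th derivative at \<open>x\<close>, a bounded \<open>n\<close>-linear map,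
  and the last clause says that the derivative of order \<open>n + 1\<close> is the Frechet derivative of the
  derivative of order \<open>n\<close> with respect to the operator norm of \<open>n\<close>-linear maps.
\<close>

definition smooth_on ::
    "'a::real_normed_vector set \<Rightarrow> ('a \<Rightarrow> 'b::real_normed_vector) \<Rightarrow> bool" where
  "smooth_on U f \<longleftrightarrow> open U \<and>
     (\<exists>D :: 'a \<Rightarrow> 'a list \<Rightarrow> 'b. \<forall>x\<in>U. D x [] = f x \<and>
        (\<forall>n. bounded_multilinear n (D x) \<and>
             (\<forall>\<epsilon>>0. \<exists>\<delta>>0. \<forall>y. norm (y - x) < \<delta> \<longrightarrow>
                (\<forall>vs. length vs = n \<longrightarrow>
                   norm (D y vs - D x vs - D x ((y - x) # vs))
                     \<le> \<epsilon> * norm (y - x) * (\<Prod>v\<leftarrow>vs. norm v)))))"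

text \<open>
  Smooth maps on a relatively open part \<open>S\<close> of an embedded submanifold: those that locally extend
  to smooth maps on the ambient space.
\<close>

definition smooth_on_submanifold ::
    "'a::real_normed_vector set \<Rightarrow> ('a \<Rightarrow> 'b::real_normed_vector) \<Rightarrow> bool" where
  "smooth_on_submanifold S f \<longleftrightarrow>
     (\<forall>x\<in>S. \<exists>U F. x \<in> U \<and> smooth_on U F \<and> (\<forall>y\<in>U \<inter> S. F y = f y))"

text \<open>
  Differential at \<open>x \<in> S\<close> of a map on the submanifold \<open>S\<close>. Only its values on vectors tangent to
  \<open>S\<close> at \<open>x\<close> are meaningful; there they do not depend on the choice made by
  \<^const>\<open>frechet_derivative\<close> and agree with the derivative of any smooth extension.
\<close>

abbreviation (input) diff_on ::
    "'a::real_normed_vector set \<Rightarrow> ('a \<Rightarrow> 'b::real_normed_vector) \<Rightarrow> 'a \<Rightarrow> 'a \<Rightarrow> 'b" where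
  "diff_on S f x \<equiv> frechet_derivative f (at x within S)"


section \<open>The spaces\<close>

text \<open>
  Elements of Lebesgue and Sobolev spaces are represented by functions; equality of elements is
  equality almost everywhere on \<open>\<Omega>\<close>.
\<close>

definition L2 :: "(real^'d) set \<Rightarrow> (real^'d \<Rightarrow> real) set" where
  "L2 \<Omega> = {f. f \<in> borel_measurable (lebesgue_on \<Omega>) \<and> integrable (lebesgue_on \<Omega>) (\<lambda>x. (f x)\<^sup>2)}"

definition L2_inner :: "(real^'d) set \<Rightarrow> (real^'d \<Rightarrow> real) \<Rightarrow> (real^'d \<Rightarrow> real) \<Rightarrow> real" where
  "L2_inner \<Omega> f g = (LINT x|lebesgue_on \<Omega>. f x * g x)"

definition test_functions :: "(real^'d) set \<Rightarrow> (real^'d \<Rightarrow> real) set" where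
  "test_functions \<Omega> = {\<psi>. smooth_on UNIV \<psi> \<and> (\<exists>K. compact K \<and> K \<subseteq> \<Omega> \<and> (\<forall>x. x \<notin> K \<longrightarrow> \<psi> x = 0))}"

definition H1 :: "(real^'d) set \<Rightarrow> (real^'d \<Rightarrow> real) set" where
  "H1 \<Omega> = {f \<in> L2 \<Omega>. \<forall>i. \<exists>g\<in>L2 \<Omega>. \<forall>\<psi>\<in>test_functions \<Omega>.
     L2_inner \<Omega> f (\<lambda>x. frechet_derivative \<psi> (at x) (axis i 1)) = - L2_inner \<Omega> g \<psi>}"

text \<open>
  A Hilbert space contained in \<open>H1 \<Omega>\<close>: the Hilbert space is the type \<open>'v\<close>, and \<open>emb\<close> assigns to
  each of its elements a representing function.
\<close>

locale sobolev_hilbert_space =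
  fixes \<Omega> :: "(real^'d) set"
    and emb :: "'v::{real_inner,banach} \<Rightarrow> real^'d \<Rightarrow> real"
  assumes dim_le_3: "CARD('d) \<le> 3"
    and domain: "open \<Omega>" "connected \<Omega>" "\<Omega> \<noteq> {}"
    and emb_H1: "emb u \<in> H1 \<Omega>"
    and emb_add: "AE x in lebesgue_on \<Omega>. emb (u + v) x = emb u x + emb v x"
    and emb_scale: "AE x in lebesgue_on \<Omega>. emb (c *\<^sub>R u) x = c * emb u x"
    and emb_inj: "(AE x in lebesgue_on \<Omega>. emb u x = emb v x) \<Longrightarrow> u = v"

text \<open>The space \<open>V\<close> is the type \<open>'v^'p\<close>; \<open>tuple_emb emb\<close> is the inclusion of \<open>V\<close> into \<open>H = H_space \<Omega>\<close>.\<close>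

definition tuple_emb :: "('v \<Rightarrow> real^'d \<Rightarrow> real) \<Rightarrow> 'v^'p \<Rightarrow> (real^'d \<Rightarrow> real)^'p" where
  "tuple_emb emb v = (\<chi> i. emb (v $ i))"

definition H_space :: "(real^'d) set \<Rightarrow> ((real^'d \<Rightarrow> real)^'p) set" where
  "H_space \<Omega> = {f. \<forall>i. f $ i \<in> L2 \<Omega>}"

definition H_matrix ::
    "(real^'d) set \<Rightarrow> (real^'d \<Rightarrow> real)^'p \<Rightarrow> (real^'d \<Rightarrow> real)^'p \<Rightarrow> real^'p^'p" where
  "H_matrix \<Omega> f g = (\<chi> i j. L2_inner \<Omega> (f $ i) (g $ j))"

definition H_inner ::
    "(real^'d) set \<Rightarrow> (real^'d \<Rightarrow> real)^'p \<Rightarrow> (real^'d \<Rightarrow> real)^'p \<Rightarrow> real" where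
  "H_inner \<Omega> f g = trace (H_matrix \<Omega> f g)"

definition H_norm :: "(real^'d) set \<Rightarrow> (real^'d \<Rightarrow> real)^'p \<Rightarrow> real" where
  "H_norm \<Omega> f = sqrt (H_inner \<Omega> f f)"

text \<open>
  For an injective linear \<open>J\<close> into \<open>H\<close>, continuity and density of its range make \<open>V \<subseteq> H \<subseteq> V\<^sup>*\<close> a
  Gelfand triple, the second inclusion being \<open>f \<mapsto> (f, \<cdot>)\<^sub>H\<close>.
\<close>

definition gelfand_triple ::
    "(real^'d) set \<Rightarrow> ('a::real_normed_vector \<Rightarrow> (real^'d \<Rightarrow> real)^'p) \<Rightarrow> bool" where
  "gelfand_triple \<Omega> J \<longleftrightarrow>
     (\<exists>C. \<forall>v. H_norm \<Omega> (J v) \<le> C * norm v) \<and>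
     (\<forall>f\<in>H_space \<Omega>. \<forall>\<epsilon>>0. \<exists>v. H_norm \<Omega> (\<chi> i. (\<lambda>x. (f $ i) x - (J v $ i) x)) < \<epsilon>)"


section \<open>The Stiefel manifold\<close>

definition gram ::
    "(real^'d) set \<Rightarrow> ('v \<Rightarrow> real^'d \<Rightarrow> real) \<Rightarrow> 'v^'p \<Rightarrow> 'v^'p \<Rightarrow> real^'p^'p" where
  "gram \<Omega> emb v w = H_matrix \<Omega> (tuple_emb emb v) (tuple_emb emb w)"

definition inner_H ::
    "(real^'d) set \<Rightarrow> ('v \<Rightarrow> real^'d \<Rightarrow> real) \<Rightarrow> 'v^'p \<Rightarrow> 'v^'p \<Rightarrow> real" where
  "inner_H \<Omega> emb v w = H_inner \<Omega> (tuple_emb emb v) (tuple_emb emb w)"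

definition tuple_mult :: "'v::real_vector^'p \<Rightarrow> real^'p^'p \<Rightarrow> 'v^'p" (infixl "*t" 70) where
  "v *t M = (\<chi> j. \<Sum>i\<in>UNIV. M $ i $ j *\<^sub>R v $ i)"

definition sym_part :: "real^'p^'p \<Rightarrow> real^'p^'p" where
  "sym_part M = (1/2) *\<^sub>R (M + transpose M)"

definition stiefel :: "(real^'d) set \<Rightarrow> ('v \<Rightarrow> real^'d \<Rightarrow> real) \<Rightarrow> ('v^'p) set" where
  "stiefel \<Omega> emb = {\<phi>. gram \<Omega> emb \<phi> \<phi> = mat 1}"

definition tangent_space ::
    "(real^'d) set \<Rightarrow> ('v \<Rightarrow> real^'d \<Rightarrow> real) \<Rightarrow> 'v^'p \<Rightarrow> ('v^'p) set" where
  "tangent_space \<Omega> emb \<phi> = {\<eta>. gram \<Omega> emb \<eta> \<phi> + gram \<Omega> emb \<phi> \<eta> = 0}"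

definition tangent_proj ::
    "(real^'d) set \<Rightarrow> ('v::real_vector \<Rightarrow> real^'d \<Rightarrow> real) \<Rightarrow> 'v^'p \<Rightarrow> 'v^'p \<Rightarrow> 'v^'p" where
  "tangent_proj \<Omega> emb \<phi> y = y - \<phi> *t sym_part (gram \<Omega> emb \<phi> y)"

text \<open>Smooth tangent vector fields on the part of the Stiefel manifold inside an open set \<open>W\<close>.\<close>

definition vector_field ::
    "(real^'d) set \<Rightarrow> ('v::real_normed_vector \<Rightarrow> real^'d \<Rightarrow> real) \<Rightarrow> ('v^'p) set \<Rightarrow>
     ('v^'p \<Rightarrow> 'v^'p) \<Rightarrow> bool" where
  "vector_field \<Omega> emb W X \<longleftrightarrow>
     smooth_on_submanifold (W \<inter> stiefel \<Omega> emb) X \<and>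
     (\<forall>\<psi>\<in>W \<inter> stiefel \<Omega> emb. X \<psi> \<in> tangent_space \<Omega> emb \<psi>)"


section \<open>The Levi-Civita connection\<close>

text \<open>
  \<open>conn \<psi> \<eta> Y\<close> is the covariant derivative at \<open>\<psi>\<close> of the vector field \<open>Y\<close> along the tangent vector
  \<open>\<eta>\<close>. Vector fields are only required to be defined near \<open>\<psi>\<close>, because the Riemannian gradient to
  be differentiated need not exist on the whole manifold.
\<close>

locale affine_connection =
  fixes \<Omega> :: "(real^'d) set"
    and emb :: "'v::{real_inner,banach} \<Rightarrow> real^'d \<Rightarrow> real"
    and conn :: "'v^'p \<Rightarrow> 'v^'p \<Rightarrow> ('v^'p \<Rightarrow> 'v^'p) \<Rightarrow> 'v^'p"
  assumes conn_field: "\<lbrakk>open W; vector_field \<Omega> emb W X; vector_field \<Omega> emb W Y\<rbrakk>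
      \<Longrightarrow> vector_field \<Omega> emb W (\<lambda>\<psi>. conn \<psi> (X \<psi>) Y)"
    and conn_local: "\<lbrakk>open W; vector_field \<Omega> emb W Y; vector_field \<Omega> emb W Z;
       \<forall>x\<in>W \<inter> stiefel \<Omega> emb. Y x = Z x; \<psi> \<in> W \<inter> stiefel \<Omega> emb; \<eta> \<in> tangent_space \<Omega> emb \<psi>\<rbrakk>
      \<Longrightarrow> conn \<psi> \<eta> Y = conn \<psi> \<eta> Z"
    and conn_linear: "\<lbrakk>open W; vector_field \<Omega> emb W Y; \<psi> \<in> W \<inter> stiefel \<Omega> emb;
       \<eta> \<in> tangent_space \<Omega> emb \<psi>; \<zeta> \<in> tangent_space \<Omega> emb \<psi>\<rbrakk>
      \<Longrightarrow> conn \<psi> (a *\<^sub>R \<eta> + b *\<^sub>R \<zeta>) Y = a *\<^sub>R conn \<psi> \<eta> Y + b *\<^sub>R conn \<psi> \<zeta> Y"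
    and conn_add: "\<lbrakk>open W; vector_field \<Omega> emb W Y; vector_field \<Omega> emb W Z;
       \<psi> \<in> W \<inter> stiefel \<Omega> emb; \<eta> \<in> tangent_space \<Omega> emb \<psi>\<rbrakk>
      \<Longrightarrow> conn \<psi> \<eta> (\<lambda>x. Y x + Z x) = conn \<psi> \<eta> Y + conn \<psi> \<eta> Z"
    and conn_Leibniz: "\<lbrakk>open W; smooth_on_submanifold (W \<inter> stiefel \<Omega> emb) f;
       vector_field \<Omega> emb W Y; \<psi> \<in> W \<inter> stiefel \<Omega> emb; \<eta> \<in> tangent_space \<Omega> emb \<psi>\<rbrakk>
      \<Longrightarrow> conn \<psi> \<eta> (\<lambda>x. f x *\<^sub>R Y x)
            = diff_on (stiefel \<Omega> emb) f \<psi> \<eta> *\<^sub>R Y \<psi> + f \<psi> *\<^sub>R conn \<psi> \<eta> Y"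

text \<open>
  The metric is only a weak Riemannian metric, for which the Koszul identity still gives
  uniqueness. Torsion-freeness \<open>\<nabla>\<^sub>X Y - \<nabla>\<^sub>Y X = [X, Y]\<close> is stated by applying both sides to smooth functions \<open>f\<close>,
  where \<open>[X, Y] f = X (Y f) - Y (X f)\<close>.
\<close>

locale levi_civita_connection = affine_connection \<Omega> emb conn
  for \<Omega> :: "(real^'d) set"
    and emb :: "'v::{real_inner,banach} \<Rightarrow> real^'d \<Rightarrow> real"
    and conn :: "'v^'p \<Rightarrow> 'v^'p \<Rightarrow> ('v^'p \<Rightarrow> 'v^'p) \<Rightarrow> 'v^'p" +
  assumes torsion_free: "\<lbrakk>open W; vector_field \<Omega> emb W X; vector_field \<Omega> emb W Y;
       smooth_on_submanifold (W \<inter> stiefel \<Omega> emb) (f :: 'v^'p \<Rightarrow> real); \<psi> \<in> W \<inter> stiefel \<Omega> emb\<rbrakk>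
      \<Longrightarrow> diff_on (stiefel \<Omega> emb) f \<psi> (conn \<psi> (X \<psi>) Y - conn \<psi> (Y \<psi>) X)
            = diff_on (stiefel \<Omega> emb) (\<lambda>x. diff_on (stiefel \<Omega> emb) f x (Y x)) \<psi> (X \<psi>)
              - diff_on (stiefel \<Omega> emb) (\<lambda>x. diff_on (stiefel \<Omega> emb) f x (X x)) \<psi> (Y \<psi>)"
    and metric_compatible: "\<lbrakk>open W; vector_field \<Omega> emb W Y; vector_field \<Omega> emb W Z;
       \<psi> \<in> W \<inter> stiefel \<Omega> emb; \<eta> \<in> tangent_space \<Omega> emb \<psi>\<rbrakk>
      \<Longrightarrow> diff_on (stiefel \<Omega> emb) (\<lambda>x. inner_H \<Omega> emb (Y x) (Z x)) \<psi> \<eta>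
            = inner_H \<Omega> emb (conn \<psi> \<eta> Y) (Z \<psi>) + inner_H \<Omega> emb (Y \<psi>) (conn \<psi> \<eta> Z)"


section \<open>Gradients and Hessians\<close>

text \<open>
  The descriptions \<open>THE\<close> below are unique because \<^const>\<open>inner_H\<close> is positive definite on \<open>V\<close>, but
  since \<open>V\<close> is not complete for it, the represented elements need not exist.
\<close>

definition represents_L2 ::
    "(real^'d) set \<Rightarrow> ('v \<Rightarrow> real^'d \<Rightarrow> real) \<Rightarrow> ('v^'p \<Rightarrow> real) \<Rightarrow> 'v^'p \<Rightarrow> bool" where
  "represents_L2 \<Omega> emb l z \<longleftrightarrow> (\<forall>w. inner_H \<Omega> emb z w = l w)"

definition second_derivative ::
    "('a::real_normed_vector \<Rightarrow> real) \<Rightarrow> 'a \<Rightarrow> 'a \<Rightarrow> 'a \<Rightarrow> real" where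
  "second_derivative F x v w = frechet_derivative (\<lambda>y. frechet_derivative F (at y) w) (at x) v"

definition L2_gradient ::
    "(real^'d) set \<Rightarrow> ('v::real_normed_vector \<Rightarrow> real^'d \<Rightarrow> real) \<Rightarrow> ('v^'p \<Rightarrow> real) \<Rightarrow>
     'v^'p \<Rightarrow> 'v^'p" where
  "L2_gradient \<Omega> emb F x = (THE z. represents_L2 \<Omega> emb (frechet_derivative F (at x)) z)"

definition L2_hessian ::
    "(real^'d) set \<Rightarrow> ('v::real_normed_vector \<Rightarrow> real^'d \<Rightarrow> real) \<Rightarrow> ('v^'p \<Rightarrow> real) \<Rightarrow>
     'v^'p \<Rightarrow> 'v^'p \<Rightarrow> 'v^'p" where
  "L2_hessian \<Omega> emb F x v = (THE z. represents_L2 \<Omega> emb (second_derivative F x v) z)"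

definition riem_grad ::
    "(real^'d) set \<Rightarrow> ('v::real_normed_vector \<Rightarrow> real^'d \<Rightarrow> real) \<Rightarrow> ('v^'p \<Rightarrow> real) \<Rightarrow>
     'v^'p \<Rightarrow> 'v^'p" where
  "riem_grad \<Omega> emb E \<psi> = (THE \<zeta>. \<zeta> \<in> tangent_space \<Omega> emb \<psi> \<and>
     (\<forall>\<eta>\<in>tangent_space \<Omega> emb \<psi>. inner_H \<Omega> emb \<zeta> \<eta> = diff_on (stiefel \<Omega> emb) E \<psi> \<eta>))"

definition riem_hess ::
    "(real^'d) set \<Rightarrow> ('v::real_normed_vector \<Rightarrow> real^'d \<Rightarrow> real) \<Rightarrow>
     ('v^'p \<Rightarrow> 'v^'p \<Rightarrow> ('v^'p \<Rightarrow> 'v^'p) \<Rightarrow> 'v^'p) \<Rightarrow> ('v^'p \<Rightarrow> real) \<Rightarrow>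
     'v^'p \<Rightarrow> 'v^'p \<Rightarrow> 'v^'p" where
  "riem_hess \<Omega> emb conn E \<phi> \<eta> = conn \<phi> \<eta> (riem_grad \<Omega> emb E)"

end

theory Submission
  imports Defs
begin

text \<open>
  The metric \<open>(\<cdot>, \<cdot>)\<^sub>H\<close> is the restriction of a fixed inner product on the linear space \<open>V\<close>, so
  its Levi-Civita connection is flat differentiation followed by orthogonal projection to the tangent
  space. The connection is given, so what has to be seen is uniqueness. The difference
  \<open>\<Gamma>(X, Y) = \<nabla>\<^sub>X Y - P (D\<^sub>X Y)\<close> is symmetric because both connections are torsion-free, and
  \<open>(\<Gamma>(X, Y), Z)\<^sub>H\<close> is antisymmetric in \<open>Y\<close> and \<open>Z\<close> because both are compatible with the metric. A
  trilinear expression that is symmetric in its first two arguments and antisymmetric in its last two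
  vanishes. This is \<open>conn_eq_tangent_proj\<close>. Prescribed values at a point are attained by the fields
  \<open>\<psi> \<mapsto> P\<^sub>\<psi> \<zeta>\<close>, whose smoothness, like that of the gradient field, rests on the Leibniz rule for
  derivatives of all orders (\<open>smooth_on_bilinear\<close>).

  Near \<open>\<phi>\<close> the Riemannian gradient is \<open>P\<^sub>\<psi>\<close> applied to the \<open>L\<^sup>2\<close>-Sobolev gradient (\<open>riem_grad_eq\<close>).
  Differentiating \<open>G \<psi> - \<psi> sym \<lbrakk>\<psi>, G \<psi>\<rbrakk>\<close> along \<open>\<eta>\<close> by the product rule gives
  \<open>DG[\<eta>] - \<eta> sym \<lbrakk>\<phi>, G \<phi>\<rbrakk>\<close> up to a term \<open>\<phi> S\<close> with \<open>S\<close> symmetric, which is normal to the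
  manifold and is removed by \<open>P\<^sub>\<phi>\<close> (\<open>tangent_proj_diff_grad\<close>); and \<open>DG\<close> is the Hessian
  (\<open>L2_hessian_eq\<close>).

  All of this presupposes that the derivative within the Stiefel manifold of a map has only one value
  on each tangent vector. For this the manifold must contain enough curves: rotations of a plane in
  the space of components, applied to each component of a tuple, preserve it, and their velocities at
  \<open>\<phi>\<close> span the tangent space (\<open>stiefel_derivative_unique\<close>).
\<close>

section \<open>Calculus of smooth maps\<close>

lemma prod_list_norm_nonneg: "0 \<le> (\<Prod>v\<leftarrow>vs. norm (v :: 'a::real_normed_vector))"
  by (induction vs) auto

text \<open>
  The family of all derivatives of a smooth map, separated from the map so that it can be
  constructed and estimated on its own.
\<close>

definition smooth_jet ::
    "'a::real_normed_vector set \<Rightarrow> ('a \<Rightarrow> 'a list \<Rightarrow> 'b::real_normed_vector) \<Rightarrow> bool" where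
  "smooth_jet U D \<longleftrightarrow> (\<forall>x\<in>U. \<forall>n. bounded_multilinear n (D x) \<and>
     (\<forall>\<epsilon>>0. \<exists>\<delta>>0. \<forall>y. norm (y - x) < \<delta> \<longrightarrow> (\<forall>vs. length vs = n \<longrightarrow>
        norm (D y vs - D x vs - D x ((y - x) # vs)) \<le> \<epsilon> * norm (y - x) * (\<Prod>v\<leftarrow>vs. norm v))))"

lemma smooth_on_iff_jet:
  "smooth_on U f \<longleftrightarrow> open U \<and> (\<exists>D. smooth_jet U D \<and> (\<forall>x\<in>U. D x [] = f x))"
  unfolding smooth_on_def smooth_jet_def by (simp only: ball_conj_distrib conj_commute)

lemma smooth_jetI:
  assumes "\<And>x n. x \<in> U \<Longrightarrow> bounded_multilinear n (D x)"
    and "\<And>x n \<epsilon>. x \<in> U \<Longrightarrow> 0 < \<epsilon> \<Longrightarrow>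
           \<exists>\<delta>>0. \<forall>y. norm (y - x) < \<delta> \<longrightarrow> (\<forall>vs. length vs = n \<longrightarrow>
              norm (D y vs - D x vs - D x ((y - x) # vs)) \<le> \<epsilon> * norm (y - x) * (\<Prod>v\<leftarrow>vs. norm v))"
  shows "smooth_jet U D"
  unfolding smooth_jet_def using assms by blast

lemma smooth_jet_multilinear: "smooth_jet U D \<Longrightarrow> x \<in> U \<Longrightarrow> bounded_multilinear n (D x)"
  unfolding smooth_jet_def by blast

lemma smooth_jet_linear: "smooth_jet U D \<Longrightarrow> x \<in> U \<Longrightarrow> i < length vs \<Longrightarrow> linear (\<lambda>v. D x (vs[i := v]))"
  using smooth_jet_multilinear[of U D x "length vs"] unfolding bounded_multilinear_def by blast

text \<open>
  Each order of differentiation comes with its own constant. The Leibniz rule mixes all orders up to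
  \<open>n\<close>, so finitely many constants are merged into one; the same is done for the radii below.
\<close>

lemma smooth_jet_bound:
  assumes "smooth_jet U D" "x \<in> U"
  obtains C where "0 \<le> C" "\<And>vs. length vs \<le> n \<Longrightarrow> norm (D x vs) \<le> C * (\<Prod>v\<leftarrow>vs. norm v)"
proof -
  have "\<forall>k. \<exists>C. \<forall>vs. length vs = k \<longrightarrow> norm (D x vs) \<le> C * (\<Prod>v\<leftarrow>vs. norm v)"
    using smooth_jet_multilinear[OF assms] unfolding bounded_multilinear_def by blast
  then obtain C where C: "\<And>vs. norm (D x vs) \<le> C (length vs) * (\<Prod>v\<leftarrow>vs. norm v)"
    by metis
  have "norm (D x vs) \<le> (\<Sum>k\<le>n. \<bar>C k\<bar>) * (\<Prod>v\<leftarrow>vs. norm v)" if "length vs \<le> n" for vs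
  proof -
    have "C (length vs) \<le> \<bar>C (length vs)\<bar>"
      by simp
    also have "\<dots> \<le> (\<Sum>k\<le>n. \<bar>C k\<bar>)"
      using that by (intro member_le_sum) auto
    finally show ?thesis
      using C[of vs] mult_right_mono[OF _ prod_list_norm_nonneg] order_trans by blast
  qed
  moreover have "0 \<le> (\<Sum>k\<le>n. \<bar>C k\<bar>)"
    by (simp add: sum_nonneg)
  ultimately show thesis
    using that by blast
qed

lemma smooth_jet_remainder:
  assumes "smooth_jet U D" "x \<in> U" "0 < \<epsilon>"
  obtains \<delta> where "\<delta> > 0" "\<And>y vs. norm (y - x) < \<delta> \<Longrightarrow> length vs \<le> n \<Longrightarrow>
      norm (D y vs - D x vs - D x ((y - x) # vs)) \<le> \<epsilon> * norm (y - x) * (\<Prod>v\<leftarrow>vs. norm v)"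
proof -
  have "\<forall>k. \<exists>\<delta>>0. \<forall>y. norm (y - x) < \<delta> \<longrightarrow> (\<forall>vs. length vs = k \<longrightarrow>
      norm (D y vs - D x vs - D x ((y - x) # vs)) \<le> \<epsilon> * norm (y - x) * (\<Prod>v\<leftarrow>vs. norm v))"
    using assms unfolding smooth_jet_def by blast
  then obtain d where d: "\<And>k. d k > 0" "\<And>k y vs. norm (y - x) < d k \<Longrightarrow> length vs = k \<Longrightarrow>
      norm (D y vs - D x vs - D x ((y - x) # vs)) \<le> \<epsilon> * norm (y - x) * (\<Prod>v\<leftarrow>vs. norm v)"
    by metis
  show thesis
  proof (rule that[of "Min (d ` {..n})"])
    fix y and vs :: "'a list" assume "norm (y - x) < Min (d ` {..n})" "length vs \<le> n"
    then show "norm (D y vs - D x vs - D x ((y - x) # vs)) \<le> \<epsilon> * norm (y - x) * (\<Prod>v\<leftarrow>vs. norm v)"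
      by (intro d(2)[of y "length vs"]) auto
  qed (use d in auto)
qed

lemma smooth_on_const:
  assumes "open U"
  shows "smooth_on U (\<lambda>x::'a::real_normed_vector. c :: 'b::real_normed_vector)"
  unfolding smooth_on_iff_jet
proof (intro conjI exI[of _ "\<lambda>x vs. if vs = [] then c else 0"] smooth_jetI)
  fix n
  show "bounded_multilinear n (\<lambda>vs :: 'a list. if vs = [] then c else 0)"
  proof (cases "n = 0")
    case True
    then show ?thesis
      unfolding bounded_multilinear_def by (auto intro!: exI[of _ "norm c"])
  next
    case False
    have "linear (\<lambda>v::'a. if vs[i := v] = [] then c else 0)" if "length vs = n" for vs :: "'a list" and i
      using that False by (auto simp: linear_iff)
    moreover have "norm (if vs = [] then c else 0) \<le> 0 * (\<Prod>v\<leftarrow>vs. norm v)" if "length vs = n" for vs :: "'a list"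
      using that False by auto
    ultimately show ?thesis
      unfolding bounded_multilinear_def by blast
  qed
next
  fix x :: 'a and n and \<epsilon> :: real assume "0 < \<epsilon>"
  then show "\<exists>\<delta>>0. \<forall>y. norm (y - x) < \<delta> \<longrightarrow> (\<forall>vs. length vs = n \<longrightarrow>
       norm ((if vs = [] then c else 0) - (if vs = [] then c else 0) - (if (y - x) # vs = [] then c else 0))
         \<le> \<epsilon> * norm (y - x) * (\<Prod>v\<leftarrow>vs. norm v))"
    by (auto intro!: exI[of _ 1] mult_nonneg_nonneg prod_list_norm_nonneg)
qed (use assms in auto)

lemma smooth_on_ident:
  assumes "open U"
  shows "smooth_on U (\<lambda>x::'a::real_normed_vector. x)"
  unfolding smooth_on_iff_jet
proof (intro conjI exI[of _ "\<lambda>x vs. if vs = [] then x else if tl vs = [] then hd vs else 0"] smooth_jetI)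
  fix n and x :: 'a
  let ?D = "\<lambda>vs. if vs = [] then x else if tl vs = [] then hd vs else 0"
  have "linear (\<lambda>v. ?D (vs[i := v]))" if "length vs = n" "i < n" for vs :: "'a list" and i
  proof (cases "tl vs = []")
    case True
    then obtain w where "vs = [w]"
      using \<open>length vs = n\<close> \<open>i < n\<close> by (cases vs) auto
    moreover have "i = 0"
      using that \<open>vs = [w]\<close> by simp
    ultimately show ?thesis
      by (simp add: linear_iff)
  next
    case False
    then have "tl (vs[i := v]) \<noteq> []" for v
      by (cases vs; cases i) auto
    then show ?thesis
      using that by (auto simp: linear_iff)
  qed
  moreover have "norm (?D vs) \<le> max (norm x) 1 * (\<Prod>v\<leftarrow>vs. norm v)" for vs :: "'a list"
  proof (cases vs)
    case (Cons w ws)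
    have "norm w \<le> max (norm x) 1 * norm w"
      by (simp add: mult_right_mono[of 1 "max (norm x) 1" "norm w", simplified])
    then show ?thesis
      using Cons prod_list_norm_nonneg[of ws] by (cases ws) auto
  qed auto
  ultimately show "bounded_multilinear n ?D"
    unfolding bounded_multilinear_def by blast
next
  fix x :: 'a and n and \<epsilon> :: real assume e: "0 < \<epsilon>"
  let ?D = "\<lambda>x vs. if vs = [] then x else if tl vs = [] then hd vs else 0"
  have "norm (?D y vs - ?D x vs - ?D x ((y - x) # vs)) \<le> \<epsilon> * norm (y - x) * (\<Prod>v\<leftarrow>vs. norm v)" for y vs
    using e prod_list_norm_nonneg[of vs] by (cases vs) auto
  then show "\<exists>\<delta>>0. \<forall>y. norm (y - x) < \<delta> \<longrightarrow> (\<forall>vs. length vs = n \<longrightarrow>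
       norm (?D y vs - ?D x vs - ?D x ((y - x) # vs)) \<le> \<epsilon> * norm (y - x) * (\<Prod>v\<leftarrow>vs. norm v))"
    by (intro exI[of _ 1]) auto
qed (use assms in auto)

text \<open>
  The derivative of \<open>x \<mapsto> B (f x) (g x)\<close> in directions \<open>v\<^sub>1, \<dots>, v\<^sub>n\<close>: the sum over all ways to
  distribute the directions, in their given order, between \<open>F\<close> and \<open>G\<close>. Recursion on the list makes
  a further direction at the head, which is where the derivative of the next order puts it, a plain
  product rule.
\<close>

fun leibniz :: "('b \<Rightarrow> 'c \<Rightarrow> 'e::plus) \<Rightarrow> ('a list \<Rightarrow> 'b) \<Rightarrow> ('a list \<Rightarrow> 'c) \<Rightarrow> 'a list \<Rightarrow> 'e" where
  "leibniz B F G [] = B (F []) (G [])"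
| "leibniz B F G (v # vs) = leibniz B (\<lambda>as. F (v # as)) G vs + leibniz B F (\<lambda>bs. G (v # bs)) vs"

context bounded_bilinear
begin

lemma leibniz_diff_left:
  "leibniz prod (\<lambda>as. F as - F' as) G vs = leibniz prod F G vs - leibniz prod F' G vs"
  by (induction vs arbitrary: F F' G) (simp_all add: diff_left)

lemma leibniz_diff_right:
  "leibniz prod F (\<lambda>as. G as - G' as) vs = leibniz prod F G vs - leibniz prod F G' vs"
  by (induction vs arbitrary: F G G') (simp_all add: diff_right)

text \<open>
  A direction at the head of the list is absorbed into the family \<open>F\<close> or \<open>G\<close> by one step of the
  recursion. Linearity in it therefore becomes linearity of \<open>leibniz\<close> in the families.
\<close>

lemma leibniz_linear_left:
  assumes "\<And>as. linear (\<lambda>v. H v as)"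
  shows "linear (\<lambda>v. leibniz prod (H v) G vs)"
  using assms
  by (induction vs arbitrary: H G)
     (auto intro!: linear_compose_add linear_compose[unfolded o_def, OF _ bounded_linear.linear[OF bounded_linear_left]])

lemma leibniz_linear_right:
  assumes "\<And>as. linear (\<lambda>v. H v as)"
  shows "linear (\<lambda>v. leibniz prod F (H v) vs)"
  using assms
  by (induction vs arbitrary: H F)
     (auto intro!: linear_compose_add linear_compose[unfolded o_def, OF _ bounded_linear.linear[OF bounded_linear_right]])

lemma leibniz_multilinear:
  assumes "\<And>as i. i < length as \<Longrightarrow> linear (\<lambda>v. F (as[i := v]))"
    and "\<And>as i. i < length as \<Longrightarrow> linear (\<lambda>v. G (as[i := v]))"
    and "i < length vs"
  shows "linear (\<lambda>v. leibniz prod F G (vs[i := v]))"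
  using assms
proof (induction vs arbitrary: F G i)
  case (Cons u us)
  show ?case
  proof (cases i)
    case 0
    have "linear (\<lambda>v. F (v # as))" "linear (\<lambda>v. G (v # as))" for as
      using Cons.prems(1,2)[of 0 "undefined # as"] by simp_all
    with 0 show ?thesis
      by (auto intro!: linear_compose_add leibniz_linear_left leibniz_linear_right)
  next
    case (Suc j)
    have "linear (\<lambda>v. F (u # as[k := v]))" "linear (\<lambda>v. G (u # as[k := v]))" if "k < length as" for as k
      using Cons.prems(1,2)[of "Suc k" "u # as"] that by simp_all
    with Suc Cons.prems show ?thesis
      by (auto intro!: linear_compose_add Cons.IH)
  qed
qed simp

text \<open>
  The factor \<open>2\<^sup>n\<close> counts the distributions of \<open>n\<close> directions.
\<close>

lemma leibniz_norm_le:
  assumes "\<And>x y. norm (prod x y) \<le> norm x * norm y * K" "0 \<le> K"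
    and "\<And>as. length as \<le> length vs \<Longrightarrow> norm (F as) \<le> a * (\<Prod>v\<leftarrow>as. norm v)"
    and "\<And>as. length as \<le> length vs \<Longrightarrow> norm (G as) \<le> b * (\<Prod>v\<leftarrow>as. norm v)"
  shows "norm (leibniz prod F G vs) \<le> 2 ^ length vs * K * a * b * (\<Prod>v\<leftarrow>vs. norm v)"
  using assms(3,4)
proof (induction vs arbitrary: F G a b)
  case Nil
  have F: "norm (F []) \<le> a" and G: "norm (G []) \<le> b"
    using Nil[of "[]"] by simp_all
  have "norm (prod (F []) (G [])) \<le> norm (F []) * norm (G []) * K"
    by (rule assms)
  also have "\<dots> \<le> a * b * K"
    using F G order_trans[OF norm_ge_zero F] by (intro mult_right_mono mult_mono assms(2)) auto
  finally show ?case
    by (simp add: mult_ac)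
next
  case (Cons v vs)
  have "norm (leibniz prod (\<lambda>as. F (v # as)) G vs) \<le> 2 ^ length vs * K * (a * norm v) * b * (\<Prod>v\<leftarrow>vs. norm v)"
    using Cons.prems(1)[of "v # as" for as] Cons.prems(2)
    by (intro Cons.IH) (auto simp: mult_ac)
  moreover have "norm (leibniz prod F (\<lambda>as. G (v # as)) vs) \<le> 2 ^ length vs * K * a * (b * norm v) * (\<Prod>v\<leftarrow>vs. norm v)"
    using Cons.prems(1) Cons.prems(2)[of "v # as" for as]
    by (intro Cons.IH) (auto simp: mult_ac)
  moreover have "norm (leibniz prod F G (v # vs)) \<le>
      norm (leibniz prod (\<lambda>as. F (v # as)) G vs) + norm (leibniz prod F (\<lambda>as. G (v # as)) vs)"
    by (simp add: norm_triangle_ineq)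
  ultimately show ?case
    by (simp add: mult_ac)
qed

text \<open>
  With \<open>F, G\<close> the derivatives at \<open>x\<close>, with \<open>F', G'\<close> those at \<open>x + h\<close>, and with \<open>F\<^sub>h, G\<^sub>h\<close> for the
  families with \<open>h\<close> put at the head, the bilinearity of \<open>leibniz\<close> in its families splits the remainder
  as in the proof of the product rule, \<open>(F' - F - F\<^sub>h) G' + F\<^sub>h (G' - G) + F (G' - G - G\<^sub>h)\<close>. The outer
  terms are small by differentiability, the middle one is of second order in \<open>h\<close>.
\<close>

lemma leibniz_remainder:
  assumes K: "\<And>x y. norm (prod x y) \<le> norm x * norm y * K" "0 \<le> K"
    and bounds: "0 \<le> a" "0 \<le> b" "0 \<le> e" "e \<le> 1" "norm h \<le> e"
    and F0: "\<And>as. length as \<le> Suc (length vs) \<Longrightarrow> norm (F as) \<le> a * (\<Prod>v\<leftarrow>as. norm v)"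
    and G0: "\<And>as. length as \<le> Suc (length vs) \<Longrightarrow> norm (G as) \<le> b * (\<Prod>v\<leftarrow>as. norm v)"
    and F1: "\<And>as. length as \<le> length vs \<Longrightarrow> norm (F' as - F as - F (h # as)) \<le> e * norm h * (\<Prod>v\<leftarrow>as. norm v)"
    and G1: "\<And>as. length as \<le> length vs \<Longrightarrow> norm (G' as - G as - G (h # as)) \<le> e * norm h * (\<Prod>v\<leftarrow>as. norm v)"
  shows "norm (leibniz prod F' G' vs - leibniz prod F G vs - leibniz prod F G (h # vs))
     \<le> 2 ^ length vs * K * ((1 + 2 * b) + a * (1 + b) + a) * e * norm h * (\<Prod>v\<leftarrow>vs. norm v)"
proof -
  let ?P = "\<lambda>as. (\<Prod>v\<leftarrow>as. norm (v :: 'd))"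
  have Fh: "norm (F (h # as)) \<le> (a * norm h) * ?P as" and Gh: "norm (G (h # as)) \<le> (b * norm h) * ?P as"
    if "length as \<le> length vs" for as
    using F0[of "h # as"] G0[of "h # as"] that by (simp_all add: mult_ac)
  have Gd: "norm (G' as - G as) \<le> ((1 + b) * norm h) * ?P as" if "length as \<le> length vs" for as
  proof -
    have "norm (G' as - G as) \<le> norm (G' as - G as - G (h # as)) + norm (G (h # as))"
      by (metis diff_add_cancel norm_triangle_ineq)
    also have "\<dots> \<le> e * norm h * ?P as + (b * norm h) * ?P as"
      using G1 Gh that by (intro add_mono) auto
    also have "\<dots> \<le> 1 * norm h * ?P as + (b * norm h) * ?P as"
      using bounds by (intro add_mono mult_right_mono prod_list_norm_nonneg) auto
    finally show ?thesis
      by (simp add: algebra_simps)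
  qed
  have G': "norm (G' as) \<le> (1 + 2 * b) * ?P as" if "length as \<le> length vs" for as
  proof -
    have "norm (G' as) \<le> norm (G' as - G as) + norm (G as)"
      by (metis diff_add_cancel norm_triangle_ineq)
    also have "\<dots> \<le> ((1 + b) * norm h) * ?P as + b * ?P as"
      using Gd G0 that by (intro add_mono) auto
    also have "\<dots> \<le> ((1 + b) * 1) * ?P as + b * ?P as"
      using bounds by (intro add_mono mult_right_mono mult_left_mono prod_list_norm_nonneg) auto
    finally show ?thesis
      by (simp add: algebra_simps)
  qed
  have split: "leibniz prod F' G' vs - leibniz prod F G vs - leibniz prod F G (h # vs)
      = leibniz prod (\<lambda>as. F' as - F as - F (h # as)) G' vs
        + leibniz prod (\<lambda>as. F (h # as)) (\<lambda>as. G' as - G as) vs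
        + leibniz prod F (\<lambda>as. G' as - G as - G (h # as)) vs"
    by (simp add: leibniz_diff_left leibniz_diff_right)
  have "norm (leibniz prod (\<lambda>as. F' as - F as - F (h # as)) G' vs)
      \<le> 2 ^ length vs * K * (e * norm h) * (1 + 2 * b) * ?P vs"
    by (intro leibniz_norm_le K F1 G')
  moreover have "norm (leibniz prod (\<lambda>as. F (h # as)) (\<lambda>as. G' as - G as) vs)
      \<le> 2 ^ length vs * K * (a * norm h) * ((1 + b) * e) * ?P vs"
  proof -
    have "norm (leibniz prod (\<lambda>as. F (h # as)) (\<lambda>as. G' as - G as) vs)
      \<le> 2 ^ length vs * K * (a * norm h) * ((1 + b) * norm h) * ?P vs"
      by (intro leibniz_norm_le K Fh Gd)
    also have "\<dots> \<le> 2 ^ length vs * K * (a * norm h) * ((1 + b) * e) * ?P vs"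
      using bounds K(2) by (intro mult_right_mono mult_left_mono prod_list_norm_nonneg mult_nonneg_nonneg) auto
    finally show ?thesis .
  qed
  moreover have "norm (leibniz prod F (\<lambda>as. G' as - G as - G (h # as)) vs)
      \<le> 2 ^ length vs * K * a * (e * norm h) * ?P vs"
    by (intro leibniz_norm_le K F0 G1) auto
  ultimately have "norm (leibniz prod (\<lambda>as. F' as - F as - F (h # as)) G' vs
        + leibniz prod (\<lambda>as. F (h # as)) (\<lambda>as. G' as - G as) vs
        + leibniz prod F (\<lambda>as. G' as - G as - G (h # as)) vs)
      \<le> 2 ^ length vs * K * (e * norm h) * (1 + 2 * b) * ?P vs
        + 2 ^ length vs * K * (a * norm h) * ((1 + b) * e) * ?P vs
        + 2 ^ length vs * K * a * (e * norm h) * ?P vs"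
    by (intro norm_triangle_le add_mono)
  then show ?thesis
    unfolding split by (simp only: distrib_left distrib_right mult_ac add_ac)
qed

lemma smooth_on_bilinear:
  fixes f :: "'x::real_normed_vector \<Rightarrow> 'a" and g :: "'x \<Rightarrow> 'b"
  assumes "smooth_on U f" "smooth_on U g"
  shows "smooth_on U (\<lambda>x. prod (f x) (g x))"
proof -
  obtain D where D: "open U" "smooth_jet U D" "\<forall>x\<in>U. D x [] = f x"
    using assms(1) unfolding smooth_on_iff_jet by blast
  obtain D' where D': "smooth_jet U D'" "\<forall>x\<in>U. D' x [] = g x"
    using assms(2) unfolding smooth_on_iff_jet by blast
  obtain K where K: "\<And>x y. norm (prod x y) \<le> norm x * norm y * K" "0 \<le> K"
    using nonneg_bounded by blast
  show ?thesis
    unfolding smooth_on_iff_jet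
  proof (intro conjI exI[of _ "\<lambda>x. leibniz prod (D x) (D' x)"] smooth_jetI)
    fix x n assume x: "x \<in> U"
    obtain a where a: "0 \<le> a" "\<And>vs. length vs \<le> n \<Longrightarrow> norm (D x vs) \<le> a * (\<Prod>v\<leftarrow>vs. norm v)"
      using smooth_jet_bound[OF D(2) x] by blast
    obtain b where b: "0 \<le> b" "\<And>vs. length vs \<le> n \<Longrightarrow> norm (D' x vs) \<le> b * (\<Prod>v\<leftarrow>vs. norm v)"
      using smooth_jet_bound[OF D'(1) x] by blast
    have "linear (\<lambda>v. D x (as[i := v]))" "linear (\<lambda>v. D' x (as[i := v]))" if "i < length as" for as i
      using smooth_jet_linear[OF D(2) x] smooth_jet_linear[OF D'(1) x] that by blast+
    then have "linear (\<lambda>v. leibniz prod (D x) (D' x) (vs[i := v]))" if "i < length vs" for vs i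
      using that by (intro leibniz_multilinear)
    moreover have "norm (leibniz prod (D x) (D' x) vs) \<le> (2 ^ n * K * a * b) * (\<Prod>v\<leftarrow>vs. norm v)"
      if "length vs = n" for vs
      using leibniz_norm_le[OF K, of vs "D x" a "D' x" b] a b that by simp
    ultimately show "bounded_multilinear n (leibniz prod (D x) (D' x))"
      unfolding bounded_multilinear_def by blast
  next
    fix x n and \<epsilon> :: real assume x: "x \<in> U" and \<epsilon>: "0 < \<epsilon>"
    obtain a where a: "0 \<le> a" "\<And>vs. length vs \<le> Suc n \<Longrightarrow> norm (D x vs) \<le> a * (\<Prod>v\<leftarrow>vs. norm v)"
      using smooth_jet_bound[OF D(2) x] by blast
    obtain b where b: "0 \<le> b" "\<And>vs. length vs \<le> Suc n \<Longrightarrow> norm (D' x vs) \<le> b * (\<Prod>v\<leftarrow>vs. norm v)"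
      using smooth_jet_bound[OF D'(1) x] by blast
    define M where "M = 2 ^ n * K * ((1 + 2 * b) + a * (1 + b) + a)"
    have M: "0 \<le> M"
      using a b K unfolding M_def by simp
    \<comment> \<open>\<open>e\<close> serves both as the precision of the two expansions and as a bound on the increment.\<close>
    define e where "e = min 1 (\<epsilon> / (M + 1))"
    have e: "0 < e" "e \<le> 1" "M * e \<le> \<epsilon>"
    proof -
      show "0 < e" "e \<le> 1"
        using M \<epsilon> by (auto simp: e_def)
      have "M * e \<le> M * (\<epsilon> / (M + 1))"
        using M by (intro mult_left_mono) (auto simp: e_def)
      also have "\<dots> \<le> \<epsilon>"
        using M \<epsilon> by (simp add: field_simps)
      finally show "M * e \<le> \<epsilon>" .
    qed
    obtain d where d: "d > 0" "\<And>y vs. norm (y - x) < d \<Longrightarrow> length vs \<le> n \<Longrightarrow>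
        norm (D y vs - D x vs - D x ((y - x) # vs)) \<le> e * norm (y - x) * (\<Prod>v\<leftarrow>vs. norm v)"
      using smooth_jet_remainder[OF D(2) x e(1)] by blast
    obtain d' where d': "d' > 0" "\<And>y vs. norm (y - x) < d' \<Longrightarrow> length vs \<le> n \<Longrightarrow>
        norm (D' y vs - D' x vs - D' x ((y - x) # vs)) \<le> e * norm (y - x) * (\<Prod>v\<leftarrow>vs. norm v)"
      using smooth_jet_remainder[OF D'(1) x e(1)] by blast
    have "norm (leibniz prod (D y) (D' y) vs - leibniz prod (D x) (D' x) vs
              - leibniz prod (D x) (D' x) ((y - x) # vs)) \<le> \<epsilon> * norm (y - x) * (\<Prod>v\<leftarrow>vs. norm v)"
      if y: "norm (y - x) < min e (min d d')" and n: "length vs = n" for y vs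
    proof -
      have "norm (leibniz prod (D y) (D' y) vs - leibniz prod (D x) (D' x) vs
              - leibniz prod (D x) (D' x) ((y - x) # vs)) \<le> M * e * norm (y - x) * (\<Prod>v\<leftarrow>vs. norm v)"
        unfolding M_def n[symmetric]
        by (rule leibniz_remainder[OF K]) (use a b e d d' y n in auto)
      also have "\<dots> \<le> \<epsilon> * norm (y - x) * (\<Prod>v\<leftarrow>vs. norm v)"
        using e by (intro mult_right_mono prod_list_norm_nonneg) auto
      finally show ?thesis .
    qed
    then show "\<exists>\<delta>>0. \<forall>y. norm (y - x) < \<delta> \<longrightarrow> (\<forall>vs. length vs = n \<longrightarrow>
        norm (leibniz prod (D y) (D' y) vs - leibniz prod (D x) (D' x) vs
              - leibniz prod (D x) (D' x) ((y - x) # vs)) \<le> \<epsilon> * norm (y - x) * (\<Prod>v\<leftarrow>vs. norm v))"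
      using e d d' by (intro exI[of _ "min e (min d d')"]) auto
  qed (use D D' in auto)
qed

end

lemma smooth_on_diff:
  fixes f g :: "'x::real_normed_vector \<Rightarrow> 'b::real_normed_vector"
  assumes "smooth_on U f" "smooth_on U g"
  shows "smooth_on U (\<lambda>x. f x - g x)"
proof -
  obtain D where D: "open U" "smooth_jet U D" "\<forall>x\<in>U. D x [] = f x"
    using assms(1) unfolding smooth_on_iff_jet by blast
  obtain D' where D': "smooth_jet U D'" "\<forall>x\<in>U. D' x [] = g x"
    using assms(2) unfolding smooth_on_iff_jet by blast
  show ?thesis
    unfolding smooth_on_iff_jet
  proof (intro conjI exI[of _ "\<lambda>x vs. D x vs - D' x vs"] smooth_jetI)
    fix x n assume x: "x \<in> U"
    obtain a where a: "\<And>vs. length vs \<le> n \<Longrightarrow> norm (D x vs) \<le> a * (\<Prod>v\<leftarrow>vs. norm v)"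
      using smooth_jet_bound[OF D(2) x] by blast
    obtain b where b: "\<And>vs. length vs \<le> n \<Longrightarrow> norm (D' x vs) \<le> b * (\<Prod>v\<leftarrow>vs. norm v)"
      using smooth_jet_bound[OF D'(1) x] by blast
    have "norm (D x vs - D' x vs) \<le> (a + b) * (\<Prod>v\<leftarrow>vs. norm v)" if "length vs = n" for vs
      using norm_triangle_ineq4[of "D x vs" "D' x vs"] a[of vs] b[of vs] that by (simp add: algebra_simps)
    moreover have "linear (\<lambda>v. D x (as[i := v]) - D' x (as[i := v]))" if "i < length as" for as i
      using smooth_jet_linear[OF D(2) x that] smooth_jet_linear[OF D'(1) x that] by (rule linear_compose_sub)
    ultimately show "bounded_multilinear n (\<lambda>vs. D x vs - D' x vs)"
      unfolding bounded_multilinear_def by blast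
  next
    fix x n and \<epsilon> :: real assume x: "x \<in> U" and \<epsilon>: "0 < \<epsilon>"
    then have \<epsilon>2: "0 < \<epsilon> / 2"
      by simp
    let ?R = "\<lambda>D y vs. norm (D y vs - D x vs - D x ((y - x) # vs))"
    obtain d where d: "d > 0" "\<And>y vs. norm (y - x) < d \<Longrightarrow> length vs = n \<Longrightarrow>
        ?R D y vs \<le> \<epsilon> / 2 * norm (y - x) * (\<Prod>v\<leftarrow>vs. norm v)"
      using smooth_jet_remainder[OF D(2) x \<epsilon>2, of n] by (metis order_refl)
    obtain d' where d': "d' > 0" "\<And>y vs. norm (y - x) < d' \<Longrightarrow> length vs = n \<Longrightarrow>
        ?R D' y vs \<le> \<epsilon> / 2 * norm (y - x) * (\<Prod>v\<leftarrow>vs. norm v)"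
      using smooth_jet_remainder[OF D'(1) x \<epsilon>2, of n] by (metis order_refl)
    have "?R (\<lambda>x vs. D x vs - D' x vs) y vs \<le> \<epsilon> * norm (y - x) * (\<Prod>v\<leftarrow>vs. norm v)"
      if y: "norm (y - x) < min d d'" and n: "length vs = n" for y vs
    proof -
      have "?R (\<lambda>x vs. D x vs - D' x vs) y vs \<le> ?R D y vs + ?R D' y vs"
        by (rule order_trans[OF _ norm_triangle_ineq4]) (simp add: algebra_simps)
      then show ?thesis
        using d(2)[of y vs] d'(2)[of y vs] y n by simp
    qed
    then show "\<exists>\<delta>>0. \<forall>y. norm (y - x) < \<delta> \<longrightarrow> (\<forall>vs. length vs = n \<longrightarrow>
        ?R (\<lambda>x vs. D x vs - D' x vs) y vs \<le> \<epsilon> * norm (y - x) * (\<Prod>v\<leftarrow>vs. norm v))"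
      using d d' by (intro exI[of _ "min d d'"]) auto
  qed (use D D' in auto)
qed

text \<open>
  Differentiability is the expansion of order \<open>0\<close>, in which the list of directions is empty.
\<close>

lemma smooth_on_imp_differentiable:
  fixes f :: "'a::real_normed_vector \<Rightarrow> 'b::real_normed_vector"
  assumes "smooth_on U f" "x \<in> U"
  shows "f differentiable (at x within S)"
proof -
  obtain D where D: "open U" "smooth_jet U D" "\<forall>x\<in>U. D x [] = f x"
    using assms(1) unfolding smooth_on_iff_jet by blast
  obtain r where r: "r > 0" "\<And>y. norm (y - x) < r \<Longrightarrow> y \<in> U"
    using D(1) assms(2) by (metis dist_norm open_dist)
  obtain C where C: "\<And>vs. length vs \<le> 1 \<Longrightarrow> norm (D x vs) \<le> C * (\<Prod>v\<leftarrow>vs. norm v)"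
    using smooth_jet_bound[OF D(2) assms(2)] by blast
  have lin: "linear (\<lambda>v. D x [v])"
    using smooth_jet_linear[OF D(2) assms(2), of 0 "[0]"] by simp
  have "(f has_derivative (\<lambda>v. D x [v])) (at x)"
    unfolding has_derivative_at_alt
  proof (intro conjI allI impI)
    show "bounded_linear (\<lambda>v. D x [v])"
      using C[of "[v]" for v] linear_add[OF lin] linear_scale[OF lin]
      by (auto intro!: bounded_linear_intro[where K = C] simp: mult.commute)
  next
    fix \<epsilon> :: real assume "0 < \<epsilon>"
    then obtain d where d: "d > 0" "\<And>y. norm (y - x) < d \<Longrightarrow> norm (D y [] - D x [] - D x [y - x]) \<le> \<epsilon> * norm (y - x)"
      using smooth_jet_remainder[OF D(2) assms(2), of \<epsilon> 0]
      by (metis (no_types, lifting) length_0_conv list.map(1) mult.right_neutral order_refl prod_list.Nil)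
    have "norm (f y - f x - D x [y - x]) \<le> \<epsilon> * norm (y - x)" if "norm (y - x) < min d r" for y
      using d(2)[of y] r(2)[of y] D(3) assms(2) that by simp
    then show "\<exists>d>0. \<forall>y. norm (y - x) < d \<longrightarrow> norm (f y - f x - D x [y - x]) \<le> \<epsilon> * norm (y - x)"
      using d(1) r(1) by (intro exI[of _ "min d r"]) auto
  qed
  then show ?thesis
    unfolding differentiable_def using has_derivative_at_withinI by blast
qed

text \<open>
  Two maps need to agree only on the part of \<open>S\<close> near \<open>x\<close>: an extension to the ambient space may
  differ from the given map everywhere off the manifold.
\<close>

lemma has_derivative_within_cong:
  assumes "(f has_derivative f') (at x within S)" "open W" "x \<in> W \<inter> S"
    and "\<And>y. y \<in> W \<inter> S \<Longrightarrow> f y = g y"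
  shows "(g has_derivative f') (at x within S)"
proof -
  obtain e where "e > 0" "\<And>y. dist y x < e \<Longrightarrow> y \<in> W"
    using assms(2,3) by (meson IntD1 open_dist)
  then show ?thesis
    using assms by (intro has_derivative_transform_within[OF assms(1), of e]) auto
qed

text \<open>
  A derivative of the zero map within \<open>S\<close>, which for a thin set \<open>S\<close> need not be zero, does vanish
  on velocities of curves that stay in \<open>S\<close>, by the chain rule and uniqueness on the real line.
\<close>

lemma derivative_along_curve_eq_0:
  fixes L :: "'a::real_normed_vector \<Rightarrow> 'b::real_normed_vector"
  assumes L: "((\<lambda>_. 0) has_derivative L) (at \<phi> within S)"
    and \<gamma>: "(\<gamma> has_vector_derivative \<xi>) (at 0)" "\<gamma> 0 = \<phi>" "\<And>t. \<gamma> t \<in> S"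
  shows "L \<xi> = 0"
proof -
  have "((\<lambda>_. 0) has_derivative L) (at (\<gamma> 0) within range \<gamma>)"
    unfolding \<gamma>(2) using \<gamma>(3) by (intro has_derivative_subset[OF L]) auto
  moreover have "(\<gamma> has_derivative (\<lambda>t. t *\<^sub>R \<xi>)) (at 0)"
    using \<gamma>(1) by (simp add: has_vector_derivative_def)
  ultimately have "((\<lambda>_. 0) has_derivative (\<lambda>t. L (t *\<^sub>R \<xi>))) (at (0::real))"
    by (rule has_derivative_in_compose[rotated])
  then have "(\<lambda>t. L (t *\<^sub>R \<xi>)) = (\<lambda>_::real. 0)"
    by (rule has_derivative_unique) (rule has_derivative_const)
  then show ?thesis
    by (metis scaleR_one)
qed

section \<open>The weak metric\<close>

lemma L2_mult_integrable:
  assumes "f \<in> L2 \<Omega>" "g \<in> L2 \<Omega>"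
  shows "integrable (lebesgue_on \<Omega>) (\<lambda>x. f x * g x)"
proof (rule Bochner_Integration.integrable_bound)
  show "integrable (lebesgue_on \<Omega>) (\<lambda>x. (f x)\<^sup>2 + (g x)\<^sup>2)"
    using assms by (auto simp: L2_def)
  show "(\<lambda>x. f x * g x) \<in> borel_measurable (lebesgue_on \<Omega>)"
    using assms by (auto simp: L2_def)
  have "\<bar>f x * g x\<bar> \<le> (f x)\<^sup>2 + (g x)\<^sup>2" for x
  proof -
    have "2 * \<bar>f x * g x\<bar> \<le> (f x)\<^sup>2 + (g x)\<^sup>2"
      using zero_le_power2[of "\<bar>f x\<bar> - \<bar>g x\<bar>"] by (simp add: power2_eq_square algebra_simps abs_mult)
    then show ?thesis
      by linarith
  qed
  then show "AE x in lebesgue_on \<Omega>. norm (f x * g x) \<le> norm ((f x)\<^sup>2 + (g x)\<^sup>2)"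
    by (intro AE_I2) simp
qed

lemma L2_inner_commute: "L2_inner \<Omega> f g = L2_inner \<Omega> g f"
  by (simp add: L2_inner_def mult.commute)

lemma L2_inner_nonneg: "0 \<le> L2_inner \<Omega> f f"
  by (simp add: L2_inner_def)

lemma norm_axis_eq: "norm (axis i u :: 'a::real_normed_vector^'n) = norm u"
proof -
  have "(\<Sum>j\<in>UNIV. (norm ((axis i u :: 'a^'n) $ j))\<^sup>2) = (\<Sum>j\<in>UNIV. if j = i then (norm u)\<^sup>2 else 0)"
    by (intro sum.cong refl) (simp add: axis_def)
  then show ?thesis
    by (simp add: norm_vec_def L2_set_def)
qed

text \<open>
  What the geometry uses of the embedding into \<open>L\<^sup>2\<close>. The metric is weak: its norm is dominated by the
  norm of \<open>'v\<close> but in general not equivalent to it.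
\<close>

locale weak_L2_metric =
  fixes \<Omega> :: "(real^'d) set"
    and emb :: "'v::real_normed_vector \<Rightarrow> real^'d \<Rightarrow> real"
  assumes bilinear: "bounded_bilinear (\<lambda>u v. L2_inner \<Omega> (emb u) (emb v))"
    and definite: "L2_inner \<Omega> (emb u) (emb u) = 0 \<Longrightarrow> u = 0"

context sobolev_hilbert_space
begin

lemma emb_L2: "emb u \<in> L2 \<Omega>"
  using emb_H1[of u] by (simp add: H1_def)

lemma L2_inner_add: "L2_inner \<Omega> (emb (u + v)) (emb w) = L2_inner \<Omega> (emb u) (emb w) + L2_inner \<Omega> (emb v) (emb w)"
proof -
  have "L2_inner \<Omega> (emb (u + v)) (emb w) = (LINT x|lebesgue_on \<Omega>. emb u x * emb w x + emb v x * emb w x)"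
    unfolding L2_inner_def
    using emb_add[of u v] L2_mult_integrable[OF emb_L2 emb_L2]
    by (intro integral_cong_AE) (auto simp: algebra_simps intro: borel_measurable_integrable)
  then show ?thesis
    by (simp add: L2_inner_def Bochner_Integration.integral_add L2_mult_integrable emb_L2)
qed

lemma L2_inner_scale: "L2_inner \<Omega> (emb (c *\<^sub>R u)) (emb w) = c * L2_inner \<Omega> (emb u) (emb w)"
proof -
  have "L2_inner \<Omega> (emb (c *\<^sub>R u)) (emb w) = (LINT x|lebesgue_on \<Omega>. c * (emb u x * emb w x))"
    unfolding L2_inner_def
    using emb_scale[of c u] L2_mult_integrable[OF emb_L2 emb_L2]
    by (intro integral_cong_AE) (auto simp: algebra_simps intro: borel_measurable_integrable)
  then show ?thesis
    by (simp add: L2_inner_def)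
qed

lemma L2_inner_definite:
  assumes "L2_inner \<Omega> (emb u) (emb u) = 0"
  shows "u = 0"
proof -
  have "AE x in lebesgue_on \<Omega>. emb u x * emb u x = 0"
    using assms integral_nonneg_eq_0_iff_AE[OF L2_mult_integrable[OF emb_L2 emb_L2, of u u]]
    by (simp add: L2_inner_def)
  moreover have "AE x in lebesgue_on \<Omega>. emb 0 x = 0"
    using emb_scale[of 0 0] by simp
  ultimately have "AE x in lebesgue_on \<Omega>. emb u x = emb 0 x"
    by eventually_elim simp
  then show ?thesis
    by (rule emb_inj)
qed

text \<open>
  The Gelfand triple bounds only the norm of tuples in \<open>H\<close>. A tuple with a single nonzero entry
  transfers the bound to one component, and expanding \<open>(u \<plusminus> v, u \<plusminus> v) \<ge> 0\<close> for unit vectors turns a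
  bound on the quadratic form into one on the bilinear form.
\<close>

lemma weak_L2_metric:
  assumes "gelfand_triple \<Omega> (tuple_emb emb :: 'v^'p \<Rightarrow> (real^'d \<Rightarrow> real)^'p)"
  shows "weak_L2_metric \<Omega> emb"
proof (rule weak_L2_metric.intro)
  let ?l = "\<lambda>u v. L2_inner \<Omega> (emb u) (emb v)"
  obtain C where C: "\<And>v :: 'v^'p. H_norm \<Omega> (tuple_emb emb v) \<le> C * norm v"
    using assms unfolding gelfand_triple_def by blast
  have square: "?l u u \<le> C\<^sup>2 * (norm u)\<^sup>2" for u
  proof -
    define v :: "'v^'p" where "v = axis undefined u"
    have zero: "?l 0 0 = 0"
      using L2_inner_scale[of 0 0 0] by simp
    have "?l u u = (\<Sum>i\<in>(UNIV :: 'p set). if i = undefined then ?l u u else 0)"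
      by simp
    also have "\<dots> = H_inner \<Omega> (tuple_emb emb v) (tuple_emb emb v)"
      unfolding H_inner_def trace_def H_matrix_def tuple_emb_def v_def axis_def
      by (intro sum.cong refl) (simp add: zero)
    also have "\<dots> = (H_norm \<Omega> (tuple_emb emb v))\<^sup>2"
      unfolding H_norm_def
      by (simp add: H_inner_def trace_def H_matrix_def sum_nonneg L2_inner_nonneg)
    also have "\<dots> \<le> (C * norm v)\<^sup>2"
      using C[of v] by (intro power_mono) (auto simp: H_norm_def H_inner_def trace_def H_matrix_def sum_nonneg L2_inner_nonneg)
    finally show ?thesis
      by (simp add: v_def norm_axis_eq power_mult_distrib)
  qed
  have add_right: "?l u (v + w) = ?l u v + ?l u w" and scale_right: "?l u (c *\<^sub>R v) = c * ?l u v" for u v w c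
    using L2_inner_add[of v w u] L2_inner_scale[of c v u] by (simp_all add: L2_inner_commute)
  have unit: "\<bar>?l u v\<bar> \<le> C\<^sup>2" if "norm u = 1" "norm v = 1" for u v
  proof -
    have "0 \<le> ?l (u + c *\<^sub>R v) (u + c *\<^sub>R v)" for c
      by (rule L2_inner_nonneg)
    then have "0 \<le> ?l u u + 2 * c * ?l u v + c\<^sup>2 * ?l v v" for c
      using L2_inner_commute[of \<Omega> "emb u" "emb v"]
      by (simp add: L2_inner_add L2_inner_scale add_right scale_right power2_eq_square algebra_simps)
    from this[of 1] this[of "-1"] show ?thesis
      using square[of u] square[of v] that by auto
  qed
  show "bounded_bilinear ?l"
  proof
    show "\<exists>K. \<forall>u v. norm (?l u v) \<le> norm u * norm v * K"
    proof (intro exI allI)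
      fix u v
      have "?l u v = norm u * norm v * ?l (sgn u) (sgn v)"
        using L2_inner_scale[of 0 0 v] scale_right[of u 0 0]
        by (cases "u = 0"; cases "v = 0") (simp_all add: sgn_div_norm L2_inner_scale scale_right field_simps)
      moreover have "norm u * norm v * \<bar>?l (sgn u) (sgn v)\<bar> \<le> norm u * norm v * C\<^sup>2"
        using unit[of "sgn u" "sgn v"]
        by (cases "u = 0"; cases "v = 0") (auto simp: norm_sgn intro!: mult_left_mono)
      ultimately show "norm (?l u v) \<le> norm u * norm v * C\<^sup>2"
        by (simp add: abs_mult)
    qed
  qed (simp_all add: L2_inner_add L2_inner_scale add_right scale_right)
  show "L2_inner \<Omega> (emb u) (emb u) = 0 \<Longrightarrow> u = 0" for u
    by (rule L2_inner_definite)
qed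

end

section \<open>Algebra of the tangent projection\<close>

lemma sym_part_nth: "sym_part M $ i $ j = (M $ i $ j + M $ j $ i) / 2"
  by (simp add: sym_part_def transpose_def)

lemma transpose_sym_part: "transpose (sym_part M) = sym_part M"
  by (simp add: vec_eq_iff transpose_def sym_part_nth add.commute)

lemma sym_part_symmetric: "transpose S = S \<Longrightarrow> sym_part S = S"
  by (simp add: sym_part_def flip: scaleR_2)

lemma sym_part_diff: "sym_part (A - B) = sym_part A - sym_part B"
  by (simp add: vec_eq_iff sym_part_nth field_simps)

text \<open>
  Symmetric and skew matrices are orthogonal: exchanging the indices changes the sign of the sum.
\<close>

lemma matrix_inner_sym_skew:
  fixes S M :: "real^'p^'p"
  assumes S: "transpose S = S" and M: "transpose M = - M"
  shows "(\<Sum>i\<in>UNIV. \<Sum>j\<in>UNIV. S $ i $ j * M $ i $ j) = 0"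
proof -
  have "(\<Sum>i\<in>UNIV. \<Sum>j\<in>UNIV. S $ i $ j * M $ i $ j) = (\<Sum>j\<in>UNIV. \<Sum>i\<in>UNIV. S $ i $ j * M $ i $ j)"
    by (rule sum.swap)
  also have "\<dots> = (\<Sum>j\<in>UNIV. \<Sum>i\<in>UNIV. - (S $ j $ i * M $ j $ i))"
  proof -
    have "S $ i $ j = S $ j $ i" "M $ i $ j = - (M $ j $ i)" for i j
      using arg_cong[OF S, of "\<lambda>A. A $ i $ j"] arg_cong[OF M, of "\<lambda>A. A $ j $ i"]
      by (simp_all add: transpose_def)
    then show ?thesis
      by (intro sum.cong refl) (metis mult_minus_right)
  qed
  finally show ?thesis
    by (simp add: sum_negf)
qed

lemma bounded_bilinear_vec:
  assumes "\<And>i. bounded_bilinear (\<lambda>x y. f x y $ i)"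
  shows "bounded_bilinear (f :: 'a::real_normed_vector \<Rightarrow> 'b::real_normed_vector \<Rightarrow> 'c::real_normed_vector^'n)"
proof
  fix a a' :: 'a and b b' :: 'b and r :: real
  show "f (a + a') b = f a b + f a' b" "f a (b + b') = f a b + f a b'"
    "f (r *\<^sub>R a) b = r *\<^sub>R f a b" "f a (r *\<^sub>R b) = r *\<^sub>R f a b"
    using assms[THEN bounded_bilinear.add_left] assms[THEN bounded_bilinear.add_right]
      assms[THEN bounded_bilinear.scaleR_left] assms[THEN bounded_bilinear.scaleR_right]
    by (auto simp: vec_eq_iff)
  have "\<forall>i. \<exists>K. \<forall>x y. norm (f x y $ i) \<le> norm x * norm y * K"
    using assms bounded_bilinear.bounded by blast
  then obtain K where K: "\<And>i x y. norm (f x y $ i) \<le> norm x * norm y * K i"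
    by metis
  have "norm (f x y) \<le> norm x * norm y * (\<Sum>i\<in>UNIV. K i)" for x y
  proof -
    have "norm (f x y) \<le> (\<Sum>i\<in>UNIV. norm (f x y $ i))"
      unfolding norm_vec_def by (rule L2_set_le_sum) simp
    also have "\<dots> \<le> (\<Sum>i\<in>UNIV. norm x * norm y * K i)"
      by (intro sum_mono K)
    finally show ?thesis
      by (simp add: sum_distrib_left)
  qed
  then show "\<exists>K. \<forall>x y. norm (f x y) \<le> norm x * norm y * K"
    by blast
qed

lemma bounded_bilinear_add:
  assumes "bounded_bilinear f" "bounded_bilinear g"
  shows "bounded_bilinear (\<lambda>x y. f x y + g x y)"
proof -
  interpret f: bounded_bilinear f by fact
  interpret g: bounded_bilinear g by fact
  obtain K where K: "\<And>x y. norm (f x y) \<le> norm x * norm y * K"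
    using f.bounded by blast
  obtain K' where K': "\<And>x y. norm (g x y) \<le> norm x * norm y * K'"
    using g.bounded by blast
  have "norm (f x y + g x y) \<le> norm x * norm y * (K + K')" for x y
    using norm_triangle_mono[OF K K'] by (simp add: distrib_left)
  then show ?thesis
    by unfold_locales
       (auto simp: f.add_left f.add_right g.add_left g.add_right f.scaleR_left f.scaleR_right
          g.scaleR_left g.scaleR_right scaleR_add_right)
qed

lemma bounded_bilinear_sum:
  assumes "\<And>i. i \<in> A \<Longrightarrow> bounded_bilinear (f i)"
  shows "bounded_bilinear (\<lambda>x y. \<Sum>i\<in>A. f i x y)"
proof -
  have zero: "bounded_bilinear (\<lambda>x y. 0)"
    by unfold_locales (auto intro: exI[of _ 0])
  show ?thesis
    using assms by (induction A rule: infinite_finite_induct) (simp_all add: zero bounded_bilinear_add)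
qed

lemma bounded_bilinear_tuple_mult:
  "bounded_bilinear ((*t) :: 'v::real_normed_vector^'p \<Rightarrow> real^'p^'p \<Rightarrow> 'v^'p)"
proof (rule bounded_bilinear_vec)
  fix j
  have "bounded_bilinear (\<lambda>(v :: 'v^'p) (M :: real^'p^'p). M $ i $ j *\<^sub>R v $ i)" for i
    by (intro bounded_bilinear.comp[OF bounded_bilinear.flip[OF bounded_bilinear_scaleR]]
        bounded_linear_vec_nth bounded_linear_compose[OF bounded_linear_vec_nth])
  then show "bounded_bilinear (\<lambda>(v :: 'v^'p) M. (v *t M) $ j)"
    unfolding tuple_mult_def by (simp add: bounded_bilinear_sum)
qed

context weak_L2_metric
begin

abbreviation ip :: "'v \<Rightarrow> 'v \<Rightarrow> real" where
  "ip u v \<equiv> L2_inner \<Omega> (emb u) (emb v)"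

interpretation ip: bounded_bilinear ip
  by (rule bilinear)

lemma gram_nth: "gram \<Omega> emb v w $ i $ j = ip (v $ i) (w $ j)"
  by (simp add: gram_def H_matrix_def tuple_emb_def)

lemma inner_H_eq: "inner_H \<Omega> emb v w = (\<Sum>i\<in>UNIV. ip (v $ i) (w $ i))"
  by (simp add: inner_H_def H_inner_def trace_def H_matrix_def tuple_emb_def)

lemma transpose_gram: "transpose (gram \<Omega> emb v w) = gram \<Omega> emb w v"
  by (simp add: vec_eq_iff transpose_def gram_nth L2_inner_commute)

lemma inner_H_commute: "inner_H \<Omega> emb v w = inner_H \<Omega> emb w v"
  by (simp add: inner_H_eq L2_inner_commute)

lemma inner_H_definite: "inner_H \<Omega> emb v v = 0 \<Longrightarrow> v = 0"
  by (auto simp: inner_H_eq sum_nonneg_eq_0_iff L2_inner_nonneg vec_eq_iff intro: definite)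

lemma bounded_bilinear_ip_nth: "bounded_bilinear (\<lambda>(v :: 'v^'p) (w :: 'v^'p). ip (v $ i) (w $ j))"
  by (intro bounded_bilinear.comp[OF bilinear] bounded_linear_vec_nth)

lemma bounded_bilinear_gram: "bounded_bilinear (gram \<Omega> emb :: 'v^'p \<Rightarrow> 'v^'p \<Rightarrow> real^'p^'p)"
  by (intro bounded_bilinear_vec) (simp add: gram_nth bounded_bilinear_ip_nth)

lemma bounded_bilinear_inner_H: "bounded_bilinear (inner_H \<Omega> emb :: 'v^'p \<Rightarrow> 'v^'p \<Rightarrow> real)"
  unfolding inner_H_eq[abs_def] by (intro bounded_bilinear_sum bounded_bilinear_ip_nth)

lemma bounded_bilinear_sym_gram:
  "bounded_bilinear (\<lambda>(v :: 'v^'p) (w :: 'v^'p). sym_part (gram \<Omega> emb v w))"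
proof (intro bounded_bilinear_vec)
  fix i j :: 'p
  have "bounded_bilinear (\<lambda>(v :: 'v^'p) (w :: 'v^'p). ip (v $ i) ((1/2) *\<^sub>R w $ j) + ip (v $ j) ((1/2) *\<^sub>R w $ i))"
    by (intro bounded_bilinear_add bounded_bilinear.comp[OF bilinear] bounded_linear_vec_nth
        bounded_linear_compose[OF bounded_linear_scaleR_right])
  then show "bounded_bilinear (\<lambda>(v :: 'v^'p) (w :: 'v^'p). sym_part (gram \<Omega> emb v w) $ i $ j)"
    by (simp add: sym_part_nth gram_nth ip.scaleR_right add_divide_distrib)
qed

lemma inner_H_eqI:
  assumes "\<And>w. inner_H \<Omega> emb u w = inner_H \<Omega> emb v w"
  shows "u = v"
proof -
  interpret H: bounded_bilinear "inner_H \<Omega> emb"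
    by (rule bounded_bilinear_inner_H)
  have "inner_H \<Omega> emb (u - v) (u - v) = 0"
    using assms by (simp add: H.diff_left)
  then show ?thesis
    using inner_H_definite by fastforce
qed

lemma tangent_space_iff_skew:
  "\<eta> \<in> tangent_space \<Omega> emb \<phi> \<longleftrightarrow> transpose (gram \<Omega> emb \<phi> \<eta>) = - gram \<Omega> emb \<phi> \<eta>"
  by (simp add: tangent_space_def transpose_gram eq_neg_iff_add_eq_0)

lemma tangent_space_diff:
  assumes "\<eta> \<in> tangent_space \<Omega> emb \<phi>" "\<zeta> \<in> tangent_space \<Omega> emb \<phi>"
  shows "\<eta> - \<zeta> \<in> tangent_space \<Omega> emb \<phi>"
proof -
  interpret G: bounded_bilinear "gram \<Omega> emb"
    by (rule bounded_bilinear_gram)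
  show ?thesis
    using assms by (simp add: tangent_space_def G.diff_left G.diff_right flip: add_diff_add)
qed

lemma stiefel_ip: "\<phi> \<in> stiefel \<Omega> emb \<Longrightarrow> ip (\<phi> $ i) (\<phi> $ j) = (if i = j then 1 else 0)"
  using gram_nth[of \<phi> \<phi> i j] by (simp add: stiefel_def mat_def)

lemma gram_tuple_mult:
  assumes "\<phi> \<in> stiefel \<Omega> emb"
  shows "gram \<Omega> emb \<phi> (\<phi> *t M) = M"
  using assms
  by (simp add: vec_eq_iff gram_nth tuple_mult_def ip.sum_right ip.scaleR_right stiefel_ip if_distrib cong: if_cong)

lemma inner_H_tuple_mult:
  "inner_H \<Omega> emb (v *t M) w = (\<Sum>i\<in>UNIV. \<Sum>j\<in>UNIV. M $ i $ j * gram \<Omega> emb v w $ i $ j)"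
  unfolding inner_H_eq
  by (subst sum.swap) (simp add: tuple_mult_def ip.sum_left ip.scaleR_left gram_nth)

text \<open>
  The normal space at \<open>\<phi>\<close> consists of the \<open>\<phi> S\<close> with \<open>S\<close> symmetric, because tangency means that
  \<open>\<lbrakk>\<phi>, \<zeta>\<rbrakk>\<close> is skew.
\<close>

lemma inner_H_normal:
  assumes "\<zeta> \<in> tangent_space \<Omega> emb \<phi>" "transpose S = S"
  shows "inner_H \<Omega> emb (\<phi> *t S) \<zeta> = 0"
  using matrix_inner_sym_skew[of S "gram \<Omega> emb \<phi> \<zeta>"] assms
  by (simp add: inner_H_tuple_mult tangent_space_iff_skew)

lemma tangent_proj_mem:
  assumes "\<phi> \<in> stiefel \<Omega> emb"
  shows "tangent_proj \<Omega> emb \<phi> y \<in> tangent_space \<Omega> emb \<phi>"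
proof -
  interpret G: bounded_bilinear "gram \<Omega> emb"
    by (rule bounded_bilinear_gram)
  have "gram \<Omega> emb \<phi> (tangent_proj \<Omega> emb \<phi> y) = gram \<Omega> emb \<phi> y - sym_part (gram \<Omega> emb \<phi> y)"
    using assms by (simp add: tangent_proj_def G.diff_right gram_tuple_mult)
  then show ?thesis
    by (simp add: tangent_space_iff_skew) (simp add: vec_eq_iff transpose_def sym_part_nth field_simps)
qed

lemma inner_H_tangent_proj:
  assumes "\<zeta> \<in> tangent_space \<Omega> emb \<phi>"
  shows "inner_H \<Omega> emb (tangent_proj \<Omega> emb \<phi> y) \<zeta> = inner_H \<Omega> emb y \<zeta>"
proof -
  interpret H: bounded_bilinear "inner_H \<Omega> emb"
    by (rule bounded_bilinear_inner_H)
  show ?thesis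
    using assms by (simp add: tangent_proj_def H.diff_left inner_H_normal transpose_sym_part)
qed

lemma tangent_proj_tangent:
  assumes "\<eta> \<in> tangent_space \<Omega> emb \<phi>"
  shows "tangent_proj \<Omega> emb \<phi> \<eta> = \<eta>"
proof -
  interpret T: bounded_bilinear "(*t) :: 'v^_ \<Rightarrow> _"
    by (rule bounded_bilinear_tuple_mult)
  have "sym_part (gram \<Omega> emb \<phi> \<eta>) = 0"
    using assms by (simp add: tangent_space_iff_skew sym_part_def)
  then show ?thesis
    by (simp add: tangent_proj_def T.zero_right)
qed

lemma tangent_proj_diff:
  "tangent_proj \<Omega> emb \<phi> (x - y) = tangent_proj \<Omega> emb \<phi> x - tangent_proj \<Omega> emb \<phi> y"
proof -
  interpret T: bounded_bilinear "(*t) :: 'v^_ \<Rightarrow> _"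
    by (rule bounded_bilinear_tuple_mult)
  interpret G: bounded_bilinear "gram \<Omega> emb"
    by (rule bounded_bilinear_gram)
  show ?thesis
    by (simp add: tangent_proj_def G.diff_right sym_part_diff T.diff_right)
qed

lemma tangent_proj_normal:
  assumes "\<phi> \<in> stiefel \<Omega> emb" "transpose S = S"
  shows "tangent_proj \<Omega> emb \<phi> (\<phi> *t S) = 0"
  using assms by (simp add: tangent_proj_def gram_tuple_mult sym_part_symmetric)

lemma tangent_eqI:
  assumes "u \<in> tangent_space \<Omega> emb \<phi>" "v \<in> tangent_space \<Omega> emb \<phi>"
    and "\<And>\<zeta>. \<zeta> \<in> tangent_space \<Omega> emb \<phi> \<Longrightarrow> inner_H \<Omega> emb u \<zeta> = inner_H \<Omega> emb v \<zeta>"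
  shows "u = v"
proof -
  interpret H: bounded_bilinear "inner_H \<Omega> emb"
    by (rule bounded_bilinear_inner_H)
  have "inner_H \<Omega> emb (u - v) (u - v) = 0"
    using assms(3)[OF tangent_space_diff[OF assms(1,2)]] by (simp add: H.diff_left)
  then show ?thesis
    using inner_H_definite by fastforce
qed

text \<open>
  \<open>P\<^sub>\<psi> y = y - \<psi> sym \<lbrakk>\<psi>, y\<rbrakk>\<close> is a polynomial in \<open>\<psi>\<close> and \<open>y\<close> built from bounded bilinear maps.
\<close>

lemma smooth_on_tangent_proj:
  fixes G :: "'v^'p \<Rightarrow> 'v^'p"
  assumes "smooth_on U G"
  shows "smooth_on U (\<lambda>\<psi>. tangent_proj \<Omega> emb \<psi> (G \<psi>))"
proof -
  have "open U"
    using assms by (simp add: smooth_on_def)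
  then show ?thesis
    unfolding tangent_proj_def
    by (intro smooth_on_diff assms bounded_bilinear.smooth_on_bilinear[OF bounded_bilinear_tuple_mult]
        bounded_bilinear.smooth_on_bilinear[OF bounded_bilinear_sym_gram] smooth_on_ident)
qed

section \<open>Differentiation along the manifold\<close>

text \<open>
  \<open>R\<close> is the rotation in the plane of the orthonormal vectors \<open>a\<close> and \<open>b\<close>, by an angle with cosine \<open>c\<close>
  and sine \<open>s\<close>; it fixes the orthogonal complement of the plane.
\<close>

lemma ip_rotation:
  assumes a: "ip a a = 1" and b: "ip b b = 1" and ab: "ip a b = 0" and cs: "c\<^sup>2 + s\<^sup>2 = 1"
  defines "R \<equiv> \<lambda>u. u + (c - 1) *\<^sub>R (ip a u *\<^sub>R a + ip b u *\<^sub>R b) + s *\<^sub>R (ip a u *\<^sub>R b - ip b u *\<^sub>R a)"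
  shows "ip (R u) (R v) = ip u v"
proof -
  have ba: "ip b a = 0" and ua: "ip u a = ip a u" and ub: "ip u b = ip b u"
    using ab by (simp_all add: L2_inner_commute)
  have s2: "s * s = 1 - c * c"
    using cs by (simp add: power2_eq_square)
  have "ip (R u) (R v) = ip u v + (2 * (c - 1) + (c - 1) * (c - 1) + s * s) * (ip a u * ip a v + ip b u * ip b v)"
    unfolding R_def
    by (simp add: ip.add_left ip.add_right ip.diff_left ip.diff_right ip.scaleR_left ip.scaleR_right a b ab ba ua ub)
       (simp add: algebra_simps)
  then show ?thesis
    by (simp add: s2 algebra_simps)
qed

text \<open>
  For orthonormal \<open>a\<close> and \<open>b\<close> the vector in question is the velocity at angle \<open>0\<close> of \<open>\<phi>\<close> rotated
  componentwise. It is alternating and bilinear in \<open>(a, b)\<close>, so Gram-Schmidt orthogonalisation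
  changes it only by a scalar factor.
\<close>

lemma derivative_along_rotation_eq_0:
  fixes L :: "'v^'p \<Rightarrow> 'b::real_normed_vector"
  assumes L: "((\<lambda>_. 0) has_derivative L) (at \<phi> within stiefel \<Omega> emb)"
    and \<phi>: "\<phi> \<in> stiefel \<Omega> emb"
  shows "L (\<chi> i. ip a (\<phi> $ i) *\<^sub>R b - ip b (\<phi> $ i) *\<^sub>R a) = 0"
proof -
  interpret L: bounded_linear L
    using L by (rule has_derivative_bounded_linear)
  define K where "K = (\<lambda>a b. (\<chi> i. ip a (\<phi> $ i) *\<^sub>R b - ip b (\<phi> $ i) *\<^sub>R a))"
  have orthonormal: "L (K a b) = 0" if "ip a a = 1" "ip b b = 1" "ip a b = 0" for a b
  proof (rule derivative_along_curve_eq_0[OF L])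
    define p where "p = (\<chi> i. ip a (\<phi> $ i) *\<^sub>R a + ip b (\<phi> $ i) *\<^sub>R b)"
    let ?\<gamma> = "\<lambda>t. \<phi> + (cos t - 1) *\<^sub>R p + sin t *\<^sub>R K a b"
    show "(?\<gamma> has_vector_derivative K a b) (at 0)"
      unfolding has_vector_derivative_def
      by (rule derivative_eq_intros refl | simp)+
    show "?\<gamma> 0 = \<phi>"
      by simp
    show "?\<gamma> t \<in> stiefel \<Omega> emb" for t
      using \<phi> ip_rotation[OF that, of "cos t" "sin t"]
      by (simp add: stiefel_def vec_eq_iff gram_nth p_def K_def)
  qed
  have "L (K a b) = 0"
  proof (cases "a = 0")
    case True
    then have "K a b = 0"
      by (simp add: K_def vec_eq_iff ip.zero_left)
    then show ?thesis
      by (simp add: L.zero)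
  next
    case False
    then have aa: "0 < ip a a"
      using definite[of a] L2_inner_nonneg[of \<Omega> "emb a"] by (auto simp: less_le)
    define b' where "b' = b - (ip a b / ip a a) *\<^sub>R a"
    have ab': "ip a b' = 0"
      using aa by (simp add: b'_def ip.diff_right ip.scaleR_right)
    have K: "K a b = K a b'"
      by (simp add: K_def b'_def vec_eq_iff ip.diff_left ip.scaleR_left algebra_simps)
    show ?thesis
    proof (cases "b' = 0")
      case True
      then have "K a b' = 0"
        by (simp add: K_def vec_eq_iff ip.zero_left)
      then show ?thesis
        by (simp add: K L.zero)
    next
      case False
      then have bb: "0 < ip b' b'"
        using definite[of b'] L2_inner_nonneg[of \<Omega> "emb b'"] by (auto simp: less_le)
      let ?r = "sqrt (ip a a)" and ?s = "sqrt (ip b' b')"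
      have "L (K ((1 / ?r) *\<^sub>R a) ((1 / ?s) *\<^sub>R b')) = 0"
        using aa bb ab' by (intro orthonormal) (simp_all add: ip.scaleR_left ip.scaleR_right)
      moreover have "K a b' = (?r * ?s) *\<^sub>R K ((1 / ?r) *\<^sub>R a) ((1 / ?s) *\<^sub>R b')"
        using aa bb by (simp add: K_def vec_eq_iff ip.scaleR_left scaleR_diff_right)
      ultimately show ?thesis
        by (simp add: K L.scaleR)
    qed
  qed
  then show ?thesis
    by (simp add: K_def)
qed

text \<open>
  Write \<open>K a b\<close> for the velocity of the preceding lemma. Since the components of \<open>\<phi>\<close> are orthonormal,
  the \<open>i\<close>-th component of \<open>\<Sum>\<^sub>j K \<phi>\<^sub>j y\<^sub>j\<close> is \<open>y\<^sub>i - \<Sum>\<^sub>j (y\<^sub>j, \<phi>\<^sub>i) \<phi>\<^sub>j\<close>, and every tangent vector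
  has this form for a suitable \<open>y\<close>. So two derivatives agree on all of the tangent space.
\<close>

lemma stiefel_derivative_unique:
  fixes f :: "'v^'p \<Rightarrow> 'b::real_normed_vector"
  assumes f: "(f has_derivative f') (at \<phi> within stiefel \<Omega> emb)" "(f has_derivative f'') (at \<phi> within stiefel \<Omega> emb)"
    and \<phi>: "\<phi> \<in> stiefel \<Omega> emb" and \<eta>: "\<eta> \<in> tangent_space \<Omega> emb \<phi>"
  shows "f' \<eta> = f'' \<eta>"
proof -
  define L where "L = (\<lambda>v. f' v - f'' v)"
  have L: "((\<lambda>_. 0) has_derivative L) (at \<phi> within stiefel \<Omega> emb)"
    using has_derivative_diff[OF f] by (simp add: L_def)
  interpret L: bounded_linear L
    using L by (rule has_derivative_bounded_linear)
  \<comment> \<open>The half of the component along \<open>\<phi>\<close> that is subtracted here comes back in the sum below: by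
    skewness, the products of \<open>y\<close> with \<open>\<phi>\<close> are minus half of those of \<open>\<phi>\<close> with \<open>\<eta>\<close>.\<close>
  define y where "y = \<eta> - (1/2) *\<^sub>R (\<phi> *t gram \<Omega> emb \<phi> \<eta>)"
  have y: "ip (y $ j) (\<phi> $ i) = - (ip (\<phi> $ j) (\<eta> $ i) / 2)" for i j
  proof -
    interpret G: bounded_bilinear "gram \<Omega> emb"
      by (rule bounded_bilinear_gram)
    have "gram \<Omega> emb y \<phi> = transpose (gram \<Omega> emb \<phi> y)"
      by (simp add: transpose_gram)
    also have "gram \<Omega> emb \<phi> y = (1/2) *\<^sub>R gram \<Omega> emb \<phi> \<eta>"
      by (simp add: y_def G.diff_right G.scaleR_right gram_tuple_mult[OF \<phi>])
    also have "transpose \<dots> = - ((1/2) *\<^sub>R gram \<Omega> emb \<phi> \<eta>)"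
      using \<eta> by (simp add: tangent_space_iff_skew transpose_scalar)
    finally have "gram \<Omega> emb y \<phi> $ j $ i = (- ((1/2) *\<^sub>R gram \<Omega> emb \<phi> \<eta>)) $ j $ i"
      by simp
    then show ?thesis
      by (simp add: gram_nth)
  qed
  have "\<eta> = (\<Sum>j\<in>UNIV. \<chi> i. ip (\<phi> $ j) (\<phi> $ i) *\<^sub>R (y $ j) - ip (y $ j) (\<phi> $ i) *\<^sub>R (\<phi> $ j))"
  proof -
    have "(\<Sum>j\<in>UNIV. ip (\<phi> $ j) (\<phi> $ i) *\<^sub>R (y $ j) - ip (y $ j) (\<phi> $ i) *\<^sub>R (\<phi> $ j)) = \<eta> $ i" for i
    proof -
      have "(\<Sum>j\<in>UNIV. ip (\<phi> $ j) (\<phi> $ i) *\<^sub>R (y $ j) - ip (y $ j) (\<phi> $ i) *\<^sub>R (\<phi> $ j))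
          = (\<Sum>j\<in>UNIV. (if j = i then y $ j else 0) + (ip (\<phi> $ j) (\<eta> $ i) / 2) *\<^sub>R (\<phi> $ j))"
        by (intro sum.cong refl) (simp add: y stiefel_ip[OF \<phi>])
      also have "\<dots> = y $ i + (\<Sum>j\<in>UNIV. (ip (\<phi> $ j) (\<eta> $ i) / 2) *\<^sub>R (\<phi> $ j))"
        by (simp add: sum.distrib)
      also have "\<dots> = \<eta> $ i"
        by (simp add: y_def tuple_mult_def gram_nth scaleR_sum_right)
      finally show ?thesis .
    qed
    then show ?thesis
      by (simp add: vec_eq_iff)
  qed
  then have "L \<eta> = (\<Sum>j\<in>UNIV. L (\<chi> i. ip (\<phi> $ j) (\<phi> $ i) *\<^sub>R (y $ j) - ip (y $ j) (\<phi> $ i) *\<^sub>R (\<phi> $ j)))"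
    by (metis (no_types) L.sum)
  then have "L \<eta> = 0"
    by (simp add: derivative_along_rotation_eq_0[OF L \<phi>])
  then show ?thesis
    by (simp add: L_def)
qed

text \<open>
  The derivative chosen by \<^const>\<open>frechet_derivative\<close> is arbitrary off the tangent space, but on
  tangent vectors it is computed by any derivative.
\<close>

lemma diff_on_stiefel_eq:
  fixes f :: "'v^'p \<Rightarrow> 'b::real_normed_vector"
  assumes "(f has_derivative f') (at \<phi> within stiefel \<Omega> emb)"
    and "\<phi> \<in> stiefel \<Omega> emb" "\<eta> \<in> tangent_space \<Omega> emb \<phi>"
  shows "diff_on (stiefel \<Omega> emb) f \<phi> \<eta> = f' \<eta>"
proof -
  have "f differentiable (at \<phi> within stiefel \<Omega> emb)"
    using assms(1) by (rule differentiableI)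
  then show ?thesis
    unfolding frechet_derivative_works
    using assms by (rule stiefel_derivative_unique)
qed

lemma smooth_on_submanifold_has_derivative:
  fixes f :: "'v^'p \<Rightarrow> 'b::real_normed_vector"
  assumes "smooth_on_submanifold (W \<inter> stiefel \<Omega> emb) f" "open W" "\<phi> \<in> W \<inter> stiefel \<Omega> emb"
  shows "(f has_derivative diff_on (stiefel \<Omega> emb) f \<phi>) (at \<phi> within stiefel \<Omega> emb)"
proof -
  have "\<exists>U F. \<phi> \<in> U \<and> smooth_on U F \<and> (\<forall>y\<in>U \<inter> (W \<inter> stiefel \<Omega> emb). F y = f y)"
    using assms(1,3) unfolding smooth_on_submanifold_def by (rule bspec)
  then obtain U F where U: "\<phi> \<in> U" "smooth_on U F" "\<forall>y\<in>U \<inter> (W \<inter> stiefel \<Omega> emb). F y = f y"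
    by blast
  have "F differentiable (at \<phi> within stiefel \<Omega> emb)"
    using U(2,1) by (rule smooth_on_imp_differentiable)
  then obtain F' where "(F has_derivative F') (at \<phi> within stiefel \<Omega> emb)"
    unfolding differentiable_def by (rule exE)
  then have "(f has_derivative F') (at \<phi> within stiefel \<Omega> emb)"
    by (rule has_derivative_within_cong[where W = "U \<inter> W"])
       (use U assms in \<open>auto simp: smooth_on_def open_Int\<close>)
  then show ?thesis
    unfolding frechet_derivative_works[symmetric] by (rule differentiableI)
qed

end

section \<open>Gradient and Hessian\<close>

context weak_L2_metric
begin

lemma L2_gradient_eq:
  fixes F :: "'v^'p \<Rightarrow> real"
  assumes "\<exists>z. represents_L2 \<Omega> emb (frechet_derivative F (at \<psi>)) z"
  shows "inner_H \<Omega> emb (L2_gradient \<Omega> emb F \<psi>) w = frechet_derivative F (at \<psi>) w"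
proof -
  have "\<exists>!z. represents_L2 \<Omega> emb (frechet_derivative F (at \<psi>)) z"
    using assms by (auto simp: represents_L2_def intro: inner_H_eqI)
  then have "represents_L2 \<Omega> emb (frechet_derivative F (at \<psi>)) (L2_gradient \<Omega> emb F \<psi>)"
    unfolding L2_gradient_def by (rule theI')
  then show ?thesis
    by (simp add: represents_L2_def)
qed

text \<open>
  The Hessian is the derivative of the gradient, as differentiation commutes with pairing against a
  fixed \<open>w\<close>.
\<close>

lemma L2_hessian_eq:
  fixes F :: "'v^'p \<Rightarrow> real"
  assumes U: "open U" "\<phi> \<in> U"
    and grad: "\<And>\<psi>. \<psi> \<in> U \<Longrightarrow> \<exists>z. represents_L2 \<Omega> emb (frechet_derivative F (at \<psi>)) z"
    and G': "(L2_gradient \<Omega> emb F has_derivative G') (at \<phi>)"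
  shows "L2_hessian \<Omega> emb F \<phi> v = G' v"
proof -
  have "second_derivative F \<phi> v w = inner_H \<Omega> emb (G' v) w" for w
  proof -
    have "((\<lambda>y. inner_H \<Omega> emb (L2_gradient \<Omega> emb F y) w) has_derivative (\<lambda>v. inner_H \<Omega> emb (G' v) w)) (at \<phi>)"
      using G' by (rule bounded_linear.has_derivative[OF bounded_bilinear.bounded_linear_left[OF bounded_bilinear_inner_H]])
    then have "((\<lambda>y. frechet_derivative F (at y) w) has_derivative (\<lambda>v. inner_H \<Omega> emb (G' v) w)) (at \<phi>)"
      using U by (rule has_derivative_transform_within_open) (simp add: L2_gradient_eq grad)
    from frechet_derivative_at[OF this] show ?thesis
      unfolding second_derivative_def by metis
  qed
  then show ?thesis
    unfolding L2_hessian_def by (intro the_equality) (auto simp: represents_L2_def intro: inner_H_eqI)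
qed

text \<open>
  Both gradients represent the same derivative, on different spaces of directions, and \<open>P\<^sub>\<psi>\<close> does not
  change inner products with tangent vectors.
\<close>

lemma riem_grad_eq:
  fixes E F :: "'v^'p \<Rightarrow> real"
  assumes F: "smooth_on U F" "\<And>\<psi>. \<psi> \<in> U \<inter> stiefel \<Omega> emb \<Longrightarrow> F \<psi> = E \<psi>"
    and \<psi>: "\<psi> \<in> U \<inter> stiefel \<Omega> emb"
    and grad: "\<exists>z. represents_L2 \<Omega> emb (frechet_derivative F (at \<psi>)) z"
  shows "riem_grad \<Omega> emb E \<psi> = tangent_proj \<Omega> emb \<psi> (L2_gradient \<Omega> emb F \<psi>)"
proof -
  have "open U"
    using F(1) by (simp add: smooth_on_def)
  have "F differentiable (at \<psi>)"
    using smooth_on_imp_differentiable[OF F(1)] \<psi> by blast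
  then have "(F has_derivative frechet_derivative F (at \<psi>)) (at \<psi> within stiefel \<Omega> emb)"
    unfolding frechet_derivative_works by (rule has_derivative_at_withinI)
  then have "(E has_derivative frechet_derivative F (at \<psi>)) (at \<psi> within stiefel \<Omega> emb)"
    using \<open>open U\<close> \<psi> F(2) by (rule has_derivative_within_cong)
  then have diff: "diff_on (stiefel \<Omega> emb) E \<psi> \<eta> = inner_H \<Omega> emb (L2_gradient \<Omega> emb F \<psi>) \<eta>"
    if "\<eta> \<in> tangent_space \<Omega> emb \<psi>" for \<eta>
    using that \<psi> by (simp add: diff_on_stiefel_eq L2_gradient_eq grad)
  show ?thesis
    unfolding riem_grad_def using \<psi>
    by (intro the_equality) (auto simp: diff tangent_proj_mem inner_H_tangent_proj intro!: tangent_eqI)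
qed

lemma vector_field_tangent_proj:
  fixes G :: "'v^'p \<Rightarrow> 'v^'p"
  assumes "smooth_on W G" "\<And>\<psi>. \<psi> \<in> W \<inter> stiefel \<Omega> emb \<Longrightarrow> X \<psi> = tangent_proj \<Omega> emb \<psi> (G \<psi>)"
  shows "vector_field \<Omega> emb W X"
  unfolding vector_field_def smooth_on_submanifold_def
proof (intro conjI ballI exI)
  fix \<psi> assume "\<psi> \<in> W \<inter> stiefel \<Omega> emb"
  then show "\<psi> \<in> W" "X \<psi> \<in> tangent_space \<Omega> emb \<psi>"
    using assms(2) by (auto simp: tangent_proj_mem)
qed (use assms in \<open>auto intro: smooth_on_tangent_proj\<close>)

text \<open>
  The derivative of \<open>P\<^sub>\<psi> (G \<psi>)\<close> has three kinds of terms: the derivative of \<open>G\<close>, that of the outer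
  factor \<open>\<psi>\<close>, and \<open>\<phi>\<close> times the derivative of a symmetric matrix. The last is normal.
\<close>

lemma tangent_proj_diff_grad:
  fixes G :: "'v^'p \<Rightarrow> 'v^'p"
  assumes W: "open W" "\<phi> \<in> W" and \<phi>: "\<phi> \<in> stiefel \<Omega> emb" and \<eta>: "\<eta> \<in> tangent_space \<Omega> emb \<phi>"
    and G': "(G has_derivative G') (at \<phi>)"
    and X: "\<And>\<psi>. \<psi> \<in> W \<inter> stiefel \<Omega> emb \<Longrightarrow> X \<psi> = tangent_proj \<Omega> emb \<psi> (G \<psi>)"
  shows "tangent_proj \<Omega> emb \<phi> (diff_on (stiefel \<Omega> emb) X \<phi> \<eta>)
    = tangent_proj \<Omega> emb \<phi> (G' \<eta> - \<eta> *t sym_part (gram \<Omega> emb \<phi> (G \<phi>)))"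
proof -
  let ?S = "\<lambda>\<psi> v. sym_part (gram \<Omega> emb \<psi> v)"
  have S: "((\<lambda>\<psi>. ?S \<psi> (G \<psi>)) has_derivative (\<lambda>v. ?S \<phi> (G' v) + ?S v (G \<phi>))) (at \<phi>)"
    by (rule bounded_bilinear.FDERIV[OF bounded_bilinear_sym_gram has_derivative_ident G'])
  have "((\<lambda>\<psi>. tangent_proj \<Omega> emb \<psi> (G \<psi>)) has_derivative
      (\<lambda>v. G' v - (\<phi> *t (?S \<phi> (G' v) + ?S v (G \<phi>)) + v *t ?S \<phi> (G \<phi>)))) (at \<phi>)"
    unfolding tangent_proj_def
    by (intro has_derivative_diff G' bounded_bilinear.FDERIV[OF bounded_bilinear_tuple_mult has_derivative_ident S])
  then have "(X has_derivative
      (\<lambda>v. G' v - (\<phi> *t (?S \<phi> (G' v) + ?S v (G \<phi>)) + v *t ?S \<phi> (G \<phi>)))) (at \<phi> within stiefel \<Omega> emb)"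
    by (rule has_derivative_within_cong[OF has_derivative_at_withinI W(1)]) (use W \<phi> X in auto)
  then have "diff_on (stiefel \<Omega> emb) X \<phi> \<eta>
      = (G' \<eta> - \<eta> *t ?S \<phi> (G \<phi>)) - \<phi> *t (?S \<phi> (G' \<eta>) + ?S \<eta> (G \<phi>))"
    using \<phi> \<eta> by (simp add: diff_on_stiefel_eq)
  moreover have "transpose (?S \<phi> (G' \<eta>) + ?S \<eta> (G \<phi>)) = ?S \<phi> (G' \<eta>) + ?S \<eta> (G \<phi>)"
    by (simp add: vec_eq_iff transpose_def sym_part_nth add.commute)
  ultimately show ?thesis
    using \<phi> by (simp only: tangent_proj_diff[of \<phi> "G' \<eta> - \<eta> *t ?S \<phi> (G \<phi>)"] tangent_proj_normal diff_zero)
qed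

lemma smooth_on_inner_H_left: "smooth_on UNIV (\<lambda>x :: 'v^'p. inner_H \<Omega> emb x w)"
  by (intro bounded_bilinear.smooth_on_bilinear[OF bounded_bilinear_inner_H] smooth_on_ident smooth_on_const) simp_all

lemma vector_field_has_derivative:
  assumes "open W" "vector_field \<Omega> emb W X" "\<phi> \<in> W \<inter> stiefel \<Omega> emb"
  shows "(X has_derivative diff_on (stiefel \<Omega> emb) X \<phi>) (at \<phi> within stiefel \<Omega> emb)"
  using assms by (intro smooth_on_submanifold_has_derivative) (auto simp: vector_field_def)

lemma vector_field_tangent:
  "vector_field \<Omega> emb W X \<Longrightarrow> \<phi> \<in> W \<inter> stiefel \<Omega> emb \<Longrightarrow> X \<phi> \<in> tangent_space \<Omega> emb \<phi>"
  by (simp add: vector_field_def)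

end

section \<open>The Levi-Civita connection\<close>

locale stiefel_levi_civita = weak_L2_metric \<Omega> emb + levi_civita_connection \<Omega> emb conn
  for \<Omega> :: "(real^'d) set"
    and emb :: "'v::{real_inner,banach} \<Rightarrow> real^'d \<Rightarrow> real"
    and conn :: "'v^'p \<Rightarrow> 'v^'p \<Rightarrow> ('v^'p \<Rightarrow> 'v^'p) \<Rightarrow> 'v^'p"
begin

lemma conn_tangent:
  assumes "open W" "vector_field \<Omega> emb W X" "vector_field \<Omega> emb W Y" "\<phi> \<in> W \<inter> stiefel \<Omega> emb"
  shows "conn \<phi> (X \<phi>) Y \<in> tangent_space \<Omega> emb \<phi>"
  using vector_field_tangent[OF conn_field[OF assms(1-3)] assms(4)] .

text \<open>
  Torsion-freeness speaks of functions. For the linear functions \<open>x \<mapsto> (x, w)\<^sub>H\<close> the iterated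
  derivatives \<open>X (Y f)\<close> are \<open>(D\<^sub>X Y, w)\<^sub>H\<close>, without second derivatives of \<open>f\<close>, and these functions
  separate the points of \<open>V\<close>. Hence the bracket of two fields is the difference of their flat
  derivatives, which in particular is tangent.
\<close>

lemma conn_torsion_free:
  assumes W: "open W" and X: "vector_field \<Omega> emb W X" and Y: "vector_field \<Omega> emb W Y"
    and \<phi>: "\<phi> \<in> W \<inter> stiefel \<Omega> emb"
  shows "conn \<phi> (X \<phi>) Y - conn \<phi> (Y \<phi>) X
    = diff_on (stiefel \<Omega> emb) Y \<phi> (X \<phi>) - diff_on (stiefel \<Omega> emb) X \<phi> (Y \<phi>)"
proof (rule inner_H_eqI)
  fix w :: "'v^'p"
  let ?St = "stiefel \<Omega> emb :: ('v^'p) set"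
  let ?f = "\<lambda>x :: 'v^'p. inner_H \<Omega> emb x w"
  interpret H: bounded_bilinear "inner_H \<Omega> emb :: 'v^'p \<Rightarrow> 'v^'p \<Rightarrow> real"
    by (rule bounded_bilinear_inner_H)
  have f: "smooth_on_submanifold (W \<inter> ?St) ?f"
    unfolding smooth_on_submanifold_def using smooth_on_inner_H_left by blast
  have linear: "diff_on ?St ?f x u = inner_H \<Omega> emb u w" if "x \<in> ?St" "u \<in> tangent_space \<Omega> emb x" for x u
    by (rule diff_on_stiefel_eq[OF bounded_linear_imp_has_derivative[OF H.bounded_linear_left] that])
  have iterated: "diff_on ?St (\<lambda>x. diff_on ?St ?f x (Z x)) \<phi> u = inner_H \<Omega> emb (diff_on ?St Z \<phi> u) w"
    if Z: "vector_field \<Omega> emb W Z" and u: "u \<in> tangent_space \<Omega> emb \<phi>" for Z u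
  proof (rule diff_on_stiefel_eq)
    have "((\<lambda>x. inner_H \<Omega> emb (Z x) w) has_derivative (\<lambda>v. inner_H \<Omega> emb (diff_on ?St Z \<phi> v) w)) (at \<phi> within ?St)"
      by (rule bounded_linear.has_derivative[OF H.bounded_linear_left vector_field_has_derivative[OF W Z \<phi>]])
    then show "((\<lambda>x. diff_on ?St ?f x (Z x)) has_derivative (\<lambda>v. inner_H \<Omega> emb (diff_on ?St Z \<phi> v) w)) (at \<phi> within ?St)"
      using W \<phi> by (rule has_derivative_within_cong) (use vector_field_tangent[OF Z] in \<open>auto simp: linear\<close>)
  qed (use \<phi> u in auto)
  have Xt: "X \<phi> \<in> tangent_space \<Omega> emb \<phi>" and Yt: "Y \<phi> \<in> tangent_space \<Omega> emb \<phi>"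
    using vector_field_tangent X Y \<phi> by blast+
  have "conn \<phi> (X \<phi>) Y - conn \<phi> (Y \<phi>) X \<in> tangent_space \<Omega> emb \<phi>"
    using conn_tangent[OF W X Y \<phi>] conn_tangent[OF W Y X \<phi>] by (rule tangent_space_diff)
  then have "inner_H \<Omega> emb (conn \<phi> (X \<phi>) Y - conn \<phi> (Y \<phi>) X) w
      = diff_on ?St ?f \<phi> (conn \<phi> (X \<phi>) Y - conn \<phi> (Y \<phi>) X)"
    using \<phi> by (simp add: linear)
  also have "\<dots> = inner_H \<Omega> emb (diff_on ?St Y \<phi> (X \<phi>)) w - inner_H \<Omega> emb (diff_on ?St X \<phi> (Y \<phi>)) w"
    unfolding torsion_free[OF W X Y f \<phi>] using iterated[OF Y Xt] iterated[OF X Yt] by simp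
  finally show "inner_H \<Omega> emb (conn \<phi> (X \<phi>) Y - conn \<phi> (Y \<phi>) X) w
      = inner_H \<Omega> emb (diff_on ?St Y \<phi> (X \<phi>) - diff_on ?St X \<phi> (Y \<phi>)) w"
    by (simp add: H.diff_left)
qed

text \<open>
  The Koszul argument in the form of a comparison: \<open>\<Gamma>\<close> measures the deviation of the connection from
  projected flat differentiation, and permuting its three arguments six times shows that it equals
  its own negative.
\<close>

lemma conn_eq_tangent_proj:
  assumes W: "open W" and Y: "vector_field \<Omega> emb W Y" and \<phi>: "\<phi> \<in> W \<inter> stiefel \<Omega> emb"
    and \<eta>: "\<eta> \<in> tangent_space \<Omega> emb \<phi>"
  shows "conn \<phi> \<eta> Y = tangent_proj \<Omega> emb \<phi> (diff_on (stiefel \<Omega> emb) Y \<phi> \<eta>)"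
proof -
  let ?St = "stiefel \<Omega> emb :: ('v^'p) set"
  let ?P = "tangent_proj \<Omega> emb \<phi>"
  interpret H: bounded_bilinear "inner_H \<Omega> emb :: 'v^'p \<Rightarrow> 'v^'p \<Rightarrow> real"
    by (rule bounded_bilinear_inner_H)
  define \<Gamma> where "\<Gamma> = (\<lambda>X Y. conn \<phi> (X \<phi>) Y - ?P (diff_on ?St Y \<phi> (X \<phi>)))"
  note field_tangent = vector_field_tangent[OF _ \<phi>]
  have tangent: "\<Gamma> X Y \<in> tangent_space \<Omega> emb \<phi>" if "vector_field \<Omega> emb W X" "vector_field \<Omega> emb W Y" for X Y
    unfolding \<Gamma>_def using \<phi> conn_tangent[OF W that \<phi>] by (intro tangent_space_diff tangent_proj_mem) auto
  have symmetric: "\<Gamma> X Y = \<Gamma> Y X" if "vector_field \<Omega> emb W X" "vector_field \<Omega> emb W Y" for X Y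
  proof -
    have "?P (conn \<phi> (X \<phi>) Y - conn \<phi> (Y \<phi>) X) = conn \<phi> (X \<phi>) Y - conn \<phi> (Y \<phi>) X"
      by (intro tangent_proj_tangent tangent_space_diff conn_tangent[OF W _ _ \<phi>] that)
    moreover have "?P (conn \<phi> (X \<phi>) Y - conn \<phi> (Y \<phi>) X)
        = ?P (diff_on ?St Y \<phi> (X \<phi>)) - ?P (diff_on ?St X \<phi> (Y \<phi>))"
      unfolding conn_torsion_free[OF W that \<phi>] by (rule tangent_proj_diff)
    ultimately show ?thesis
      unfolding \<Gamma>_def by (simp add: algebra_simps)
  qed
  have skew: "inner_H \<Omega> emb (\<Gamma> X Y) (Z \<phi>) = - inner_H \<Omega> emb (\<Gamma> X Z) (Y \<phi>)"
    if X: "vector_field \<Omega> emb W X" and Y: "vector_field \<Omega> emb W Y" and Z: "vector_field \<Omega> emb W Z" for X Y Z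
  proof -
    have "diff_on ?St (\<lambda>x. inner_H \<Omega> emb (Y x) (Z x)) \<phi> (X \<phi>)
        = inner_H \<Omega> emb (Y \<phi>) (diff_on ?St Z \<phi> (X \<phi>)) + inner_H \<Omega> emb (diff_on ?St Y \<phi> (X \<phi>)) (Z \<phi>)"
      using \<phi> field_tangent[OF X]
      by (intro diff_on_stiefel_eq H.FDERIV vector_field_has_derivative[OF W _ \<phi>] Y Z) auto
    moreover have "inner_H \<Omega> emb (Y \<phi>) v = inner_H \<Omega> emb (?P v) (Y \<phi>)" "inner_H \<Omega> emb v (Z \<phi>) = inner_H \<Omega> emb (?P v) (Z \<phi>)" for v
      using field_tangent[OF Y] field_tangent[OF Z] inner_H_commute[of "Y \<phi>" v] by (simp_all add: inner_H_tangent_proj)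
    ultimately show ?thesis
      using metric_compatible[OF W Y Z \<phi> field_tangent[OF X]] inner_H_commute[of "Y \<phi>" "conn \<phi> (X \<phi>) Z"]
      unfolding \<Gamma>_def by (simp add: H.diff_left)
  qed
  \<comment> \<open>Projecting a constant field extends any tangent vector at \<open>\<phi>\<close> to a smooth tangent field.\<close>
  define ext where "ext = (\<lambda>(\<zeta> :: 'v^'p) \<psi>. tangent_proj \<Omega> emb \<psi> \<zeta>)"
  have ext: "vector_field \<Omega> emb W (ext \<zeta>)" for \<zeta>
    by (rule vector_field_tangent_proj[OF smooth_on_const[OF W]]) (simp add: ext_def)
  have ext_at: "ext \<zeta> \<phi> = \<zeta>" if "\<zeta> \<in> tangent_space \<Omega> emb \<phi>" for \<zeta>
    using that by (simp add: ext_def tangent_proj_tangent)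
  have "inner_H \<Omega> emb (\<Gamma> (ext \<eta>) Y) \<zeta> = 0" if "\<zeta> \<in> tangent_space \<Omega> emb \<phi>" for \<zeta>
  proof -
    let ?X = "ext \<eta>" and ?Z = "ext \<zeta>"
    let ?c = "\<lambda>X Y Z. inner_H \<Omega> emb (\<Gamma> X Y) (Z \<phi>)"
    have "?c ?X Y ?Z = - ?c ?X ?Z Y"
      by (rule skew[OF ext Y ext])
    also have "\<dots> = - ?c ?Z ?X Y"
      by (simp only: symmetric[OF ext ext])
    also have "\<dots> = ?c ?Z Y ?X"
      by (simp only: skew[OF ext ext Y] minus_minus)
    also have "\<dots> = ?c Y ?Z ?X"
      by (simp only: symmetric[OF ext Y])
    also have "\<dots> = - ?c Y ?X ?Z"
      by (rule skew[OF Y ext ext])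
    also have "\<dots> = - ?c ?X Y ?Z"
      by (simp only: symmetric[OF ext Y])
    finally show ?thesis
      using that by (simp add: ext_at)
  qed
  then have "\<Gamma> (ext \<eta>) Y = 0"
    using inner_H_definite[of "\<Gamma> (ext \<eta>) Y"] tangent[OF ext Y] by blast
  then show ?thesis
    by (simp add: \<Gamma>_def ext_at[OF \<eta>])
qed

end

theorem theorem3p1:
  fixes \<Omega> :: "(real^'d) set"
    and emb :: "'v::{real_inner,banach} \<Rightarrow> real^'d \<Rightarrow> real"
    and conn :: "'v^'p \<Rightarrow> 'v^'p \<Rightarrow> ('v^'p \<Rightarrow> 'v^'p) \<Rightarrow> 'v^'p"
    and E Ebar :: "'v^'p \<Rightarrow> real"
    and U :: "('v^'p) set"
    and \<phi> \<eta> :: "'v^'p"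
  assumes "sobolev_hilbert_space \<Omega> emb"
    and "gelfand_triple \<Omega> (tuple_emb emb :: 'v^'p \<Rightarrow> (real^'d \<Rightarrow> real)^'p)"
    and "levi_civita_connection \<Omega> emb conn"
    and "\<phi> \<in> stiefel \<Omega> emb"
    and "\<eta> \<in> tangent_space \<Omega> emb \<phi>"
    and "smooth_on_submanifold (stiefel \<Omega> emb) E"
    and "open U" "\<phi> \<in> U"
    and "smooth_on U Ebar"
    and "\<forall>\<psi>\<in>U \<inter> stiefel \<Omega> emb. Ebar \<psi> = E \<psi>"
    and "\<forall>\<psi>\<in>U. \<exists>z. represents_L2 \<Omega> emb (frechet_derivative Ebar (at \<psi>)) z"
    and "\<forall>\<psi>\<in>U. \<forall>v. \<exists>z. represents_L2 \<Omega> emb (second_derivative Ebar \<psi> v) z"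
    and "smooth_on U (L2_gradient \<Omega> emb Ebar)"
  shows "riem_hess \<Omega> emb conn E \<phi> \<eta>
           = tangent_proj \<Omega> emb \<phi> (diff_on (stiefel \<Omega> emb) (riem_grad \<Omega> emb E) \<phi> \<eta>)
       \<and> tangent_proj \<Omega> emb \<phi> (diff_on (stiefel \<Omega> emb) (riem_grad \<Omega> emb E) \<phi> \<eta>)
           = tangent_proj \<Omega> emb \<phi> (L2_hessian \<Omega> emb Ebar \<phi> \<eta>
               - \<eta> *t sym_part (gram \<Omega> emb \<phi> (L2_gradient \<Omega> emb Ebar \<phi>)))"
proof
  let ?G = "L2_gradient \<Omega> emb Ebar"
  interpret metric: weak_L2_metric \<Omega> emb
    using assms(1,2) by (rule sobolev_hilbert_space.weak_L2_metric)
  interpret levi_civita_connection \<Omega> emb conn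
    by (rule assms)
  interpret stiefel_levi_civita \<Omega> emb conn
    by unfold_locales
  have grad: "riem_grad \<Omega> emb E \<psi> = tangent_proj \<Omega> emb \<psi> (?G \<psi>)" if "\<psi> \<in> U \<inter> stiefel \<Omega> emb" for \<psi>
    using assms that by (intro metric.riem_grad_eq[OF assms(9)]) auto
  show "riem_hess \<Omega> emb conn E \<phi> \<eta>
      = tangent_proj \<Omega> emb \<phi> (diff_on (stiefel \<Omega> emb) (riem_grad \<Omega> emb E) \<phi> \<eta>)"
    unfolding riem_hess_def
    using assms(4,5,7,8) metric.vector_field_tangent_proj[OF assms(13) grad]
    by (intro conn_eq_tangent_proj[where W = U]) auto
  have G': "(?G has_derivative frechet_derivative ?G (at \<phi>)) (at \<phi>)"
    using smooth_on_imp_differentiable[OF assms(13,8)] by (simp add: frechet_derivative_works)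
  then have "L2_hessian \<Omega> emb Ebar \<phi> \<eta> = frechet_derivative ?G (at \<phi>) \<eta>"
    using assms(7,8,11) by (intro metric.L2_hessian_eq) auto
  then show "tangent_proj \<Omega> emb \<phi> (diff_on (stiefel \<Omega> emb) (riem_grad \<Omega> emb E) \<phi> \<eta>)
      = tangent_proj \<Omega> emb \<phi> (L2_hessian \<Omega> emb Ebar \<phi> \<eta> - \<eta> *t sym_part (gram \<Omega> emb \<phi> (?G \<phi>)))"
    using metric.tangent_proj_diff_grad[OF assms(7,8,4,5) G' grad] by simp
qed

end
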